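(* Fix $j_0\in\mathcal{N}\setminus\{1\}$. Suppose that for each $j\in\mathcal{N}\setminus\{1,j_0\}$ the two-marginal problem $\inf\{\int c_{1j}\,d\tau:\tau\in\Pi(\mu_1,\mu_j)\}$ has its optimal plan induced by a unique transport map $T_j:X_1\to X_j$, i.e. the optimal plan is $(\mathrm{id}\times T_j)\#\mu_1$. Let $\lambda$ be an optimal plan of (MKP) and write $\pi_{1j_0}\#\lambda=\mu^{x_1}_{j_0}\otimes\mu_1$ with $\mu_{j_0}^{x_1}\in P(X_{j_0})$. Then $$\lambda=\Big(\prod_{j=2}^{j_0-1}\delta_{T_j(x_1)}\times\mu^{x_1}_{j_0}\times\prod_{j=j_0+1}^N\delta_{T_j(x_1)}\Big)\otimes\mu_1.$$ If in addition the two-marginal problem for $j=j_0$ has a unique solution, then (MKP) has a unique optimal plan.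
   Context: Let $N\ge 3$, $\mathcal{N}=\{1,\ldots,N\}$, $\mu_k$ Borel probability measures on complete separable metric spaces $X_k$; $\Pi(\cdot)$ denotes sets of probability measures with prescribed marginals. The cost $c:\prod_kX_k\to\mathbb{R}$ is lower semicontinuous with $c\ge\sum_ka_k(x_k)$, $a_k\in L_1(\mu_k)$; (MKP) is $\inf\{\int c\,d\lambda:\lambda\in\Pi(\mu_1,\ldots,\mu_N)\}$, assumed attained (minimizers = optimal plans). $(\varphi_1,\ldots,\varphi_N)$ is a fixed solution of the dual problem $\sup\{\sum_k\int\varphi_kd\mu_k:\varphi_k\in L_1(\mu_k),\sum_k\varphi_k(x_k)\le c\}$. For $j\in\mathcal{N}\setminus\{1\}$, $$c_{1j}(x_1,x_j)=\inf_{(x_k)_{k\in\mathcal{N}\setminus\{1,j\}}}\Big\{c(x_1,\ldots,x_N)-\sum_{k\in\mathcal{N}\setminus\{1,j\}}\varphi_k(x_k)\Big\},$$ and $\pi_{1j}:\prod_kX_k\to X_1\times X_j$ is the projection. For a measure $\sigma$ on $A$ and a measurable family $(\eta^a)$ of probability measures on $B$, $(\eta^a\otimes\sigma)(E\times F)=\int_E\eta^a(F)d\sigma(a)$; $\delta_y$ is a Dirac mass; the product of measures in the displayed formula is taken in the coordinate order $X_2,\ldots,X_N$. *)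

theory Defs
  imports "HOL-Probability.Probability"
begin

definition borel_of :: "'a topology \<Rightarrow> 'a measure" where
  "borel_of T = sigma (topspace T) {U. openin T U}"

definition lsc_top :: "'a topology \<Rightarrow> ('a \<Rightarrow> real) \<Rightarrow> bool" where
  "lsc_top T f \<longleftrightarrow> (\<forall>t. openin T {x \<in> topspace T. t < f x})"

definition plans :: "nat \<Rightarrow> (nat \<Rightarrow> 'a measure) \<Rightarrow> (nat \<Rightarrow> 'a) measure set" where
  "plans N \<mu> = {P. sets P = sets (PiM {1..N} \<mu>) \<and>
                    (\<forall>k\<in>{1..N}. distr P (\<mu> k) (\<lambda>x. x k) = \<mu> k)}"

text \<open>Optimal plans of (MKP) (the minimum is finite, since c is bounded below by an
  integrable function and the dual problem has a solution).\<close>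
definition opt_MK :: "nat \<Rightarrow> (nat \<Rightarrow> 'a measure) \<Rightarrow> ((nat \<Rightarrow> 'a) \<Rightarrow> real)
                       \<Rightarrow> (nat \<Rightarrow> 'a) measure \<Rightarrow> bool" where
  "opt_MK N \<mu> c P \<longleftrightarrow> P \<in> plans N \<mu> \<and> integrable P c \<and>
     (\<forall>P'\<in>plans N \<mu>. integrable P' c \<longrightarrow> (\<integral>x. c x \<partial>P) \<le> (\<integral>x. c x \<partial>P'))"

definition dual_adm :: "nat \<Rightarrow> (nat \<Rightarrow> 'a metric) \<Rightarrow> (nat \<Rightarrow> 'a measure)
                         \<Rightarrow> ((nat \<Rightarrow> 'a) \<Rightarrow> real) \<Rightarrow> (nat \<Rightarrow> 'a \<Rightarrow> real) \<Rightarrow> bool" where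
  "dual_adm N X \<mu> c \<psi> \<longleftrightarrow> (\<forall>k\<in>{1..N}. integrable (\<mu> k) (\<psi> k)) \<and>
     (\<forall>x\<in>PiE {1..N} (\<lambda>k. mspace (X k)). (\<Sum>k\<in>{1..N}. \<psi> k (x k)) \<le> c x)"

definition dual_sol :: "nat \<Rightarrow> (nat \<Rightarrow> 'a metric) \<Rightarrow> (nat \<Rightarrow> 'a measure)
                         \<Rightarrow> ((nat \<Rightarrow> 'a) \<Rightarrow> real) \<Rightarrow> (nat \<Rightarrow> 'a \<Rightarrow> real) \<Rightarrow> bool" where
  "dual_sol N X \<mu> c \<phi> \<longleftrightarrow> dual_adm N X \<mu> c \<phi> \<and>
     (\<forall>\<psi>. dual_adm N X \<mu> c \<psi> \<longrightarrow>
        (\<Sum>k\<in>{1..N}. \<integral>x. \<psi> k x \<partial>\<mu> k) \<le> (\<Sum>k\<in>{1..N}. \<integral>x. \<phi> k x \<partial>\<mu> k))"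

definition cost_1j :: "nat \<Rightarrow> (nat \<Rightarrow> 'a metric) \<Rightarrow> ((nat \<Rightarrow> 'a) \<Rightarrow> real)
                        \<Rightarrow> (nat \<Rightarrow> 'a \<Rightarrow> real) \<Rightarrow> nat \<Rightarrow> 'a \<Rightarrow> 'a \<Rightarrow> real" where
  "cost_1j N X c \<phi> j x1 xj =
     Inf {c ((y(1 := x1))(j := xj)) - (\<Sum>k\<in>{1..N} - {1, j}. \<phi> k (y k)) | y.
            y \<in> PiE ({1..N} - {1, j}) (\<lambda>k. mspace (X k))}"

text \<open>Two-marginal plans Pi(mu, nu) and optimal plans for a cost f.  Since the
  reduced cost need not be Borel, integrals are taken w.r.t. the completion.\<close>
definition plans2 :: "'a measure \<Rightarrow> 'b measure \<Rightarrow> ('a \<times> 'b) measure set" where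
  "plans2 \<mu> \<nu> = {\<tau>. sets \<tau> = sets (\<mu> \<Otimes>\<^sub>M \<nu>) \<and> distr \<tau> \<mu> fst = \<mu> \<and> distr \<tau> \<nu> snd = \<nu>}"

definition opt2 :: "'a measure \<Rightarrow> 'b measure \<Rightarrow> ('a \<times> 'b \<Rightarrow> real) \<Rightarrow> ('a \<times> 'b) measure \<Rightarrow> bool" where
  "opt2 \<mu> \<nu> f \<tau> \<longleftrightarrow> \<tau> \<in> plans2 \<mu> \<nu> \<and> integrable (completion \<tau>) f \<and>
     (\<forall>\<tau>'\<in>plans2 \<mu> \<nu>. integrable (completion \<tau>') f \<longrightarrow>
        (\<integral>z. f z \<partial>completion \<tau>) \<le> (\<integral>z. f z \<partial>completion \<tau>'))"

end

theory Submission
  imports Defs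
begin

text \<open>
  Without a duality gap, \<open>c\<close> equals \<open>\<Sum>k. \<phi> k (x k)\<close> almost everywhere for an optimal plan \<open>P\<close>,
  whereas the reduced cost always dominates \<open>\<phi> 1 + \<phi> j\<close>.  So the reduced cost equals
  \<open>\<phi> 1 + \<phi> j\<close> almost everywhere for the marginal of \<open>P\<close> on \<open>X 1 \<times> X j\<close>, and this marginal solves
  the two-marginal problem.  By uniqueness of that solution \<open>x j = T j (x 1)\<close> almost everywhere for
  \<open>j \<noteq> j0\<close>, and \<open>P\<close> is the image of its marginal on \<open>X 1 \<times> X j0\<close>.

  The duality itself follows from Hahn--Banach: below the superhedging price there is a linear
  functional on bounded functions, that is, a finitely additive plan of cost at most the dual value.
  Its marginals are tight, which makes it countably additive on boxes; the resulting measure is at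
  most the finitely additive one on open sets, and hence, by lower semicontinuity, its cost does not
  exceed the dual value.
\<close>

section \<open>Hahn--Banach\<close>

definition sublinear :: "('v::real_vector \<Rightarrow> real) \<Rightarrow> bool" where
  "sublinear p \<longleftrightarrow> (\<forall>x y. p (x + y) \<le> p x + p y) \<and> (\<forall>x. \<forall>r>0. p (r *\<^sub>R x) = r * p x)"

lemma sublinear_add: "sublinear p \<Longrightarrow> p (x + y) \<le> p x + p y"
  by (simp add: sublinear_def)

lemma sublinear_scale_pos: "sublinear p \<Longrightarrow> r > 0 \<Longrightarrow> p (r *\<^sub>R x) = r * p x"
  by (simp add: sublinear_def)

lemma sublinear_0: "sublinear p \<Longrightarrow> p 0 = 0"
  using sublinear_scale_pos[of p 2 0] by simp

lemma sublinear_scale: "sublinear p \<Longrightarrow> r \<ge> 0 \<Longrightarrow> p (r *\<^sub>R x) = r * p x"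
  by (cases "r = 0") (simp_all add: sublinear_0 sublinear_scale_pos)

lemma sublinear_uminus_ge: "sublinear p \<Longrightarrow> - p (- x) \<le> p x"
  using sublinear_add[of p x "- x"] by (simp add: sublinear_0)

lemma sublinear_Inf:
  fixes S :: "'v::real_vector \<Rightarrow> real set"
  assumes nonempty: "\<And>x. S x \<noteq> {}" and bdd: "\<And>x. bdd_below (S x)"
    and add: "\<And>x y u v. u \<in> S x \<Longrightarrow> v \<in> S y \<Longrightarrow> \<exists>w\<in>S (x + y). w \<le> u + v"
    and scale: "\<And>x u r. u \<in> S x \<Longrightarrow> r > 0 \<Longrightarrow> r * u \<in> S (r *\<^sub>R x)"
  shows "sublinear (\<lambda>x. Inf (S x))"
proof -
  have add_le: "Inf (S (x + y)) \<le> Inf (S x) + Inf (S y)" for x y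
  proof -
    have sum_ge: "Inf (S (x + y)) \<le> u + v" if "u \<in> S x" "v \<in> S y" for u v
      using add[OF that] cInf_lower[OF _ bdd] order_trans by blast
    have "Inf (S (x + y)) - u \<le> Inf (S y)" if "u \<in> S x" for u
      using sum_ge[OF that] by (intro cInf_greatest nonempty) (simp add: diff_le_eq add.commute)
    then have "Inf (S (x + y)) - Inf (S y) \<le> Inf (S x)"
      by (intro cInf_greatest nonempty) (simp add: algebra_simps)
    then show ?thesis by simp
  qed
  have scale_le: "Inf (S (r *\<^sub>R x)) \<le> r * Inf (S x)" if "r > 0" for r x
  proof -
    have "Inf (S (r *\<^sub>R x)) / r \<le> u" if "u \<in> S x" for u
      using cInf_lower[OF scale[OF that \<open>r > 0\<close>] bdd] \<open>r > 0\<close> by (simp add: field_simps)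
    then have "Inf (S (r *\<^sub>R x)) / r \<le> Inf (S x)" by (intro cInf_greatest nonempty)
    then show ?thesis using \<open>r > 0\<close> by (simp add: field_simps)
  qed
  have "r * Inf (S x) \<le> Inf (S (r *\<^sub>R x))" if "r > 0" for r x
    using scale_le[of "inverse r" "r *\<^sub>R x"] that by (simp add: field_simps)
  then show ?thesis unfolding sublinear_def using add_le scale_le by (simp add: antisym)
qed

lemma sublinear_odd_imp_linear:
  assumes sublinear: "sublinear p" and odd: "\<And>x. p (- x) \<le> - p x"
  shows "linear p"
proof (rule linearI)
  have uminus: "p (- x) = - p x" for x
    using odd[of x] sublinear_uminus_ge[OF sublinear, of x] by linarith
  show "p (x + y) = p x + p y" for x y
    using sublinear_add[OF sublinear, of x y] sublinear_add[OF sublinear, of "- x" "- y"]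
      uminus[of "x + y"]
    by (simp add: uminus)
  show "p (r *\<^sub>R x) = r *\<^sub>R p x" for r x
  proof (cases "r \<ge> 0")
    case False
    then have "p ((- r) *\<^sub>R (- x)) = (- r) * p (- x)" by (intro sublinear_scale[OF sublinear]) simp
    then show ?thesis by (simp add: uminus)
  qed (simp add: sublinear_scale[OF sublinear])
qed

lemma sublinear_INF_chain:
  fixes C :: "('v::real_vector \<Rightarrow> real) set"
  assumes "C \<noteq> {}" and sublinear: "\<And>p. p \<in> C \<Longrightarrow> sublinear p" and dominated: "\<And>p. p \<in> C \<Longrightarrow> p \<le> q"
    and chain: "\<And>p p'. p \<in> C \<Longrightarrow> p' \<in> C \<Longrightarrow> p \<le> p' \<or> p' \<le> p"
  shows "sublinear (\<lambda>x. INF p\<in>C. p x)" and "\<And>p. p \<in> C \<Longrightarrow> (\<lambda>x. INF p\<in>C. p x) \<le> p"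
proof -
  have bdd: "bdd_below ((\<lambda>p. p x) ` C)" for x
  proof (rule bdd_belowI2)
    show "- q (- x) \<le> p x" if "p \<in> C" for p
      using sublinear_uminus_ge[OF sublinear[OF that], of x]
        le_funD[OF dominated[OF that], of "- x"] by linarith
  qed
  then show "(\<lambda>x. INF p\<in>C. p x) \<le> p" if "p \<in> C" for p
    using that by (intro le_funI cINF_lower)
  show "sublinear (\<lambda>x. INF p\<in>C. p x)"
  proof (rule sublinear_Inf)
    fix x y u v assume "u \<in> (\<lambda>p. p x) ` C" "v \<in> (\<lambda>p. p y) ` C"
    then obtain p p' where p: "p \<in> C" "u = p x" and p': "p' \<in> C" "v = p' y" by blast
    then obtain p'' where p'': "p'' \<in> C" "p'' \<le> p" "p'' \<le> p'" using chain by blast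
    have "p'' (x + y) \<le> p'' x + p'' y" by (rule sublinear_add[OF sublinear[OF p''(1)]])
    also have "\<dots> \<le> u + v" using p''(2,3) by (auto simp: p p' le_fun_def intro: add_mono)
    finally show "\<exists>w\<in>(\<lambda>p. p (x + y)) ` C. w \<le> u + v" using p''(1) by blast
  next
    fix x u and r :: real assume "u \<in> (\<lambda>p. p x) ` C" and r: "r > 0"
    then obtain p where p: "p \<in> C" "u = p x" by blast
    then have "r * u = p (r *\<^sub>R x)" by (simp add: sublinear_scale_pos[OF sublinear r])
    then show "r * u \<in> (\<lambda>p. p (r *\<^sub>R x)) ` C" using p(1) by blast
  qed (use \<open>C \<noteq> {}\<close> bdd in auto)
qed

definition directional_INF :: "('v::real_vector \<Rightarrow> real) \<Rightarrow> 'v \<Rightarrow> 'v \<Rightarrow> real" where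
  "directional_INF p y x = (INF t\<in>{0..}. p (x + t *\<^sub>R y) - t * p y)"

lemma bdd_below_directional_INF:
  assumes "sublinear p"
  shows "bdd_below ((\<lambda>t. p (x + t *\<^sub>R y) - t * p y) ` {0..})"
proof (rule bdd_belowI2)
  show "- p (- x) \<le> p (x + t *\<^sub>R y) - t * p y" if "t \<in> {0..}" for t
    using sublinear_add[OF assms, of "x + t *\<^sub>R y" "- x"] sublinear_scale[OF assms, of t y] that
    by simp
qed

lemma directional_INF_le:
  assumes "sublinear p" "t \<ge> 0"
  shows "directional_INF p y x \<le> p (x + t *\<^sub>R y) - t * p y"
  unfolding directional_INF_def
  using assms bdd_below_directional_INF by (intro cINF_lower) auto

lemma sublinear_directional_INF:
  fixes p :: "'v::real_vector \<Rightarrow> real"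
  assumes sublinear: "sublinear p"
  shows "sublinear (directional_INF p y)"
  unfolding directional_INF_def
proof (rule sublinear_Inf)
  let ?S = "\<lambda>x. (\<lambda>t. p (x + t *\<^sub>R y) - t * p y) ` {0..}"
  show "bdd_below (?S x)" for x by (rule bdd_below_directional_INF[OF sublinear])
  fix x x' u v assume "u \<in> ?S x" "v \<in> ?S x'"
  then obtain s t where s: "s \<ge> 0" "u = p (x + s *\<^sub>R y) - s * p y"
    and t: "t \<ge> 0" "v = p (x' + t *\<^sub>R y) - t * p y" by auto
  have "p (x + x' + (s + t) *\<^sub>R y) \<le> p (x + s *\<^sub>R y) + p (x' + t *\<^sub>R y)"
    using sublinear_add[OF sublinear, of "x + s *\<^sub>R y" "x' + t *\<^sub>R y"]
    by (simp add: algebra_simps)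
  then have "p (x + x' + (s + t) *\<^sub>R y) - (s + t) * p y \<le> u + v" by (simp add: s t algebra_simps)
  then show "\<exists>w\<in>?S (x + x'). w \<le> u + v" using s(1) t(1) by (auto intro!: bexI[of _ "s + t"])
next
  let ?S = "\<lambda>x. (\<lambda>t. p (x + t *\<^sub>R y) - t * p y) ` {0..}"
  fix x u and r :: real assume "u \<in> ?S x" and r: "r > 0"
  then obtain s where s: "s \<ge> 0" "u = p (x + s *\<^sub>R y) - s * p y" by auto
  have "r * u = p (r *\<^sub>R x + (r * s) *\<^sub>R y) - (r * s) * p y"
    using sublinear_scale_pos[OF sublinear r, of "x + s *\<^sub>R y"] by (simp add: s algebra_simps)
  then show "r * u \<in> ?S (r *\<^sub>R x)" using r s(1) by (auto intro!: image_eqI[of _ _ "r * s"])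
qed auto

lemma minimal_sublinear_exists:
  fixes q :: "'v::real_vector \<Rightarrow> real"
  assumes "sublinear q"
  obtains p where "sublinear p" "p \<le> q" "\<And>p'. sublinear p' \<Longrightarrow> p' \<le> p \<Longrightarrow> p' = p"
proof -
  define S where "S = {p. sublinear p \<and> p \<le> q}"
  have "\<exists>p\<in>S. \<forall>p'\<in>S. p' \<le> p \<longrightarrow> p' = p"
  proof (rule predicate_Zorn)
    show "partial_order_on S (relation_of (\<lambda>p p'. p' \<le> p) S)"
      by (rule partial_order_on_relation_ofI) auto
    fix C assume "C \<in> Chains (relation_of (\<lambda>p p'. p' \<le> p) S)"
    then have C: "C \<subseteq> S" "\<And>p p'. p \<in> C \<Longrightarrow> p' \<in> C \<Longrightarrow> p \<le> p' \<or> p' \<le> p"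
      by (auto simp: Chains_def relation_of_def)
    show "\<exists>u\<in>S. \<forall>p\<in>C. u \<le> p"
    proof (cases "C = {}")
      case True
      then show ?thesis using assms by (auto simp: S_def)
    next
      case False
      then have "sublinear (\<lambda>x. INF p\<in>C. p x)" "\<forall>p\<in>C. (\<lambda>x. INF p\<in>C. p x) \<le> p"
        using sublinear_INF_chain[of C q] C by (auto simp: S_def subset_iff)
      moreover from this(2) False C(1) have "(\<lambda>x. INF p\<in>C. p x) \<le> q"
        by (auto simp: S_def intro: order_trans)
      ultimately show ?thesis unfolding S_def by blast
    qed
  qed
  then obtain p where "p \<in> S" and minimal: "\<And>p'. p' \<in> S \<Longrightarrow> p' \<le> p \<Longrightarrow> p' = p" by blast
  then have "p' = p" if "sublinear p'" "p' \<le> p" for p'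
    using that by (auto simp: S_def intro: order_trans)
  then show thesis using that[of p] \<open>p \<in> S\<close> by (auto simp: S_def)
qed

theorem sublinear_dominates_linear:
  fixes q :: "'v::real_vector \<Rightarrow> real"
  assumes "sublinear q"
  obtains L where "linear L" "L \<le> q"
proof -
  obtain p where sublinear: "sublinear p" and le_q: "p \<le> q"
    and minimal: "\<And>p'. sublinear p' \<Longrightarrow> p' \<le> p \<Longrightarrow> p' = p"
    using minimal_sublinear_exists[OF assms] by metis
  have "p (- y) \<le> - p y" for y
  proof -
    have "directional_INF p y \<le> p"
      using directional_INF_le[OF sublinear, of 0 y] by (auto intro: le_funI)
    then have "directional_INF p y = p" by (rule minimal[OF sublinear_directional_INF[OF sublinear]])
    then show ?thesis
      using directional_INF_le[OF sublinear, of 1 y "- y"] by (simp add: sublinear_0[OF sublinear])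
  qed
  then show thesis using that[of p] sublinear_odd_imp_linear[OF sublinear] le_q by blast
qed

text \<open>On the discrete copy of a type every function is continuous, so \<^typ>\<open>'x discrete \<Rightarrow>\<^sub>C real\<close> is
  the space of all bounded functions on \<^typ>\<open>'x\<close>.\<close>

definition bounded_indicator :: "'x set \<Rightarrow> 'x discrete \<Rightarrow>\<^sub>C real" where
  "bounded_indicator E = Bcontfun (\<lambda>z. indicator E (of_discrete z))"

lemma apply_bounded_indicator [simp]: "bounded_indicator E (discrete x) = indicator E x"
proof -
  have "(\<lambda>z. indicator E (of_discrete z) :: real) \<in> bcontfun"
    by (rule bcontfun_normI[of _ 1])
      (auto simp: indicator_def continuous_on_open_vimage open_discrete)
  then show ?thesis
    by (simp add: bounded_indicator_def Bcontfun_inverse discrete_inverse)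
qed

lemma bounded_indicator_Un_disjoint:
  assumes "E \<inter> F = {}"
  shows "bounded_indicator (E \<union> F) = bounded_indicator E + bounded_indicator F"
proof (rule bcontfun_eqI)
  fix z :: "'a discrete"
  obtain x where "z = discrete x" by (metis of_discrete_inverse)
  then show "bounded_indicator (E \<union> F) z = (bounded_indicator E + bounded_indicator F) z"
    using assms by (simp add: plus_bcontfun.rep_eq indicator_add[symmetric])
qed

lemma apply_bcontfun_sum: "apply_bcontfun (\<Sum>i\<in>J. f i) x = (\<Sum>i\<in>J. apply_bcontfun (f i) x)"
  by (induction J rule: infinite_finite_induct) (simp_all add: plus_bcontfun.rep_eq)

section \<open>Borel sets of abstract topologies\<close>

lemma space_borel_of [simp]: "space (borel_of T) = topspace T"
  by (simp add: borel_of_def space_measure_of_conv)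

lemma sets_borel_of: "sets (borel_of T) = sigma_sets (topspace T) {U. openin T U}"
  unfolding borel_of_def by (rule sets_measure_of) (auto dest: openin_subset)

lemma borel_of_open: "openin T U \<Longrightarrow> U \<in> sets (borel_of T)"
  by (auto simp: sets_borel_of)

lemma borel_of_closed: "closedin T C \<Longrightarrow> C \<in> sets (borel_of T)"
  using sets.compl_sets[OF borel_of_open[of T "topspace T - C"]] closedin_subset[of T C]
  by (auto simp: closedin_def double_diff)

lemma continuous_map_borel_measurable:
  assumes "continuous_map S T f"
  shows "f \<in> borel_of S \<rightarrow>\<^sub>M borel_of T"
proof -
  have "f \<in> borel_of S \<rightarrow>\<^sub>M sigma (topspace T) {U. openin T U}"
  proof (rule measurable_measure_of)
    fix U assume "U \<in> {U. openin T U}"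
    then have "openin S {x \<in> topspace S. f x \<in> U}"
      using assms by (simp add: openin_continuous_map_preimage)
    moreover have "f -` U \<inter> space (borel_of S) = {x \<in> topspace S. f x \<in> U}" by auto
    ultimately show "f -` U \<inter> space (borel_of S) \<in> sets (borel_of S)" by (simp add: borel_of_open)
  qed (use assms in \<open>auto dest: openin_subset simp: continuous_map_def\<close>)
  then show ?thesis by (simp add: borel_of_def[of T])
qed

definition countable_base :: "'x topology \<Rightarrow> 'x set set \<Rightarrow> bool" where
  "countable_base T \<B> \<longleftrightarrow> countable \<B> \<and> (\<forall>V\<in>\<B>. openin T V) \<and>
     (\<forall>U x. openin T U \<and> x \<in> U \<longrightarrow> (\<exists>V\<in>\<B>. x \<in> V \<and> V \<subseteq> U))"

lemma second_countable_iff_countable_base: "second_countable T \<longleftrightarrow> (\<exists>\<B>. countable_base T \<B>)"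
  by (simp add: second_countable_def countable_base_def)

lemma countable_baseD:
  assumes "countable_base T \<B>"
  shows "countable \<B>" and "V \<in> \<B> \<Longrightarrow> openin T V"
    and "openin T U \<Longrightarrow> x \<in> U \<Longrightarrow> \<exists>V\<in>\<B>. x \<in> V \<and> V \<subseteq> U"
  using assms by (auto simp: countable_base_def)

lemma countable_base_Union:
  assumes "countable_base T \<B>" "openin T W"
  shows "\<Union>{V\<in>\<B>. V \<subseteq> W} = W"
  using countable_baseD(3)[OF assms] by blast

lemma countable_base_Times:
  assumes base_S: "countable_base S \<B>" and base_T: "countable_base T \<C>"
  shows "countable_base (prod_topology S T) ((\<lambda>(U, V). U \<times> V) ` (\<B> \<times> \<C>))"
  unfolding countable_base_def
proof (intro conjI allI impI)
  show "countable ((\<lambda>(U, V). U \<times> V) ` (\<B> \<times> \<C>))"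
    using countable_baseD(1)[OF base_S] countable_baseD(1)[OF base_T] by simp
  show "\<forall>W\<in>(\<lambda>(U, V). U \<times> V) ` (\<B> \<times> \<C>). openin (prod_topology S T) W"
    using countable_baseD(2)[OF base_S] countable_baseD(2)[OF base_T]
    by (auto simp: openin_prod_Times_iff)
  fix W z assume W: "openin (prod_topology S T) W \<and> z \<in> W"
  obtain x y where z: "z = (x, y)" by (cases z)
  obtain U V where "openin S U" "x \<in> U" "openin T V" "y \<in> V" and UV: "U \<times> V \<subseteq> W"
    using W unfolding openin_prod_topology_alt z by blast
  then obtain U' V' where "U' \<in> \<B>" "x \<in> U'" "U' \<subseteq> U" "V' \<in> \<C>" "y \<in> V'" "V' \<subseteq> V"
    using countable_baseD(3)[OF base_S] countable_baseD(3)[OF base_T] by meson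
  then show "\<exists>V\<in>(\<lambda>(U, V). U \<times> V) ` (\<B> \<times> \<C>). z \<in> V \<and> V \<subseteq> W"
    using UV unfolding z by (intro bexI[of _ "U' \<times> V'"]) auto
qed

lemma countable_base_PiE:
  assumes finite: "finite I" and bases: "\<And>i. i \<in> I \<Longrightarrow> countable_base (X i) (\<B> i)"
  shows "countable_base (product_topology X I) (PiE I ` PiE I \<B>)"
  unfolding countable_base_def
proof (intro conjI allI impI ballI)
  show "countable (PiE I ` PiE I \<B>)"
    using finite bases by (intro countable_image countable_PiE) (auto dest: countable_baseD(1))
  show "openin (product_topology X I) V" if V: "V \<in> PiE I ` PiE I \<B>" for V
  proof -
    obtain U where U: "U \<in> PiE I \<B>" "V = PiE I U" using V by (rule imageE)
    have "openin (X i) (U i)" if "i \<in> I" for i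
      using countable_baseD(2)[OF bases[OF that] PiE_mem[OF U(1) that]] .
    then show ?thesis using finite by (simp add: U(2) openin_PiE_gen)
  qed
  fix W x assume W: "openin (product_topology X I) W \<and> x \<in> W"
  then obtain U where U: "\<forall>i\<in>I. openin (X i) (U i)" "x \<in> PiE I U" "PiE I U \<subseteq> W"
    unfolding openin_product_topology_alt by blast
  have "\<forall>i\<in>I. \<exists>V. V \<in> \<B> i \<and> x i \<in> V \<and> V \<subseteq> U i"
    using countable_baseD(3)[OF bases] U(1) PiE_mem[OF U(2)] by blast
  from bchoice[OF this] obtain V where V: "\<forall>i\<in>I. V i \<in> \<B> i \<and> x i \<in> V i \<and> V i \<subseteq> U i" ..
  have "PiE I V = PiE I (restrict V I)" by (rule PiE_cong) simp
  moreover have "restrict V I \<in> PiE I \<B>" using V by simp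
  ultimately have "PiE I V \<in> PiE I ` PiE I \<B>" by (rule image_eqI)
  moreover have "x \<in> PiE I V" using V U(2) by (simp add: PiE_iff)
  moreover have "PiE I V \<subseteq> W"
    using PiE_mono[of I V U] V U(3) by (simp add: subset_trans[of "PiE I V" "PiE I U" W])
  ultimately show "\<exists>V\<in>PiE I ` PiE I \<B>. x \<in> V \<and> V \<subseteq> W" by (intro bexI[of _ "PiE I V"] conjI)
qed

lemma borel_of_subset_sets:
  assumes base: "countable_base T \<B>" and base_sets: "\<B> \<subseteq> sets M"
  shows "sets (borel_of T) \<subseteq> sets M"
proof -
  have "W \<in> sets M" if "openin T W" for W
  proof -
    have "\<Union>{V\<in>\<B>. V \<subseteq> W} \<in> sets M"
      using base_sets countable_baseD(1)[OF base] by (intro sets.countable_Union) auto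
    then show ?thesis by (simp add: countable_base_Union[OF base that])
  qed
  then show ?thesis unfolding sets_borel_of by (intro sets.sigma_sets_subset') auto
qed

lemma sets_subset_of_measurable_id:
  assumes "(\<lambda>x. x) \<in> M \<rightarrow>\<^sub>M N" "space M = space N"
  shows "sets N \<subseteq> sets M"
proof
  fix A assume A: "A \<in> sets N"
  then show "A \<in> sets M"
    using measurable_sets[OF assms(1) A] sets.sets_into_space[OF A] assms(2)
    by (simp add: Int_absorb2)
qed

lemma sets_pair_measure_borel_of:
  assumes "second_countable S" "second_countable T"
  shows "sets (borel_of S \<Otimes>\<^sub>M borel_of T) = sets (borel_of (prod_topology S T))"
proof
  have "fst \<in> borel_of (prod_topology S T) \<rightarrow>\<^sub>M borel_of S"
    "snd \<in> borel_of (prod_topology S T) \<rightarrow>\<^sub>M borel_of T"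
    by (intro continuous_map_borel_measurable continuous_map_fst continuous_map_snd)+
  from measurable_Pair[OF this]
  show "sets (borel_of S \<Otimes>\<^sub>M borel_of T) \<subseteq> sets (borel_of (prod_topology S T))"
    by (intro sets_subset_of_measurable_id) (simp_all add: space_pair_measure)
  obtain \<B> \<C> where "countable_base S \<B>" "countable_base T \<C>"
    using assms unfolding second_countable_iff_countable_base by blast
  then show "sets (borel_of (prod_topology S T)) \<subseteq> sets (borel_of S \<Otimes>\<^sub>M borel_of T)"
    by (intro borel_of_subset_sets[OF countable_base_Times])
      (auto dest: countable_baseD(2) intro: borel_of_open)
qed

lemma sets_PiM_borel_of:
  assumes finite: "finite I" and second_countable: "\<And>i. i \<in> I \<Longrightarrow> second_countable (X i)"
  shows "sets (PiM I (\<lambda>i. borel_of (X i))) = sets (borel_of (product_topology X I))"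
proof
  have "(\<lambda>x. x i) \<in> borel_of (product_topology X I) \<rightarrow>\<^sub>M borel_of (X i)" if "i \<in> I" for i
    using that by (intro continuous_map_borel_measurable continuous_map_product_projection)
  then show "sets (PiM I (\<lambda>i. borel_of (X i))) \<subseteq> sets (borel_of (product_topology X I))"
    by (intro sets_subset_of_measurable_id measurable_PiM_single') (auto simp: space_PiM)
  obtain \<B> where \<B>: "\<And>i. i \<in> I \<Longrightarrow> countable_base (X i) (\<B> i)"
    using second_countable unfolding second_countable_iff_countable_base by metis
  have "PiE I V \<in> sets (PiM I (\<lambda>i. borel_of (X i)))" if "V \<in> PiE I \<B>" for V
    using finite that
    by (intro sets_PiM_I_finite borel_of_open) (auto intro: countable_baseD(2)[OF \<B>])
  then show "sets (borel_of (product_topology X I)) \<subseteq> sets (PiM I (\<lambda>i. borel_of (X i)))"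
    by (intro borel_of_subset_sets[OF countable_base_PiE[OF finite \<B>]]) auto
qed

lemma (in Metric_space) separable_imp_second_countable:
  assumes "separable_space mtopology"
  shows "second_countable mtopology"
proof -
  obtain D where D: "countable D" "D \<subseteq> M" "mtopology closure_of D = M"
    using assms unfolding separable_space_def by auto
  let ?\<B> = "(\<lambda>(q, n). mball q (1 / real (Suc n))) ` (D \<times> UNIV)"
  have "countable_base mtopology ?\<B>"
    unfolding countable_base_def
  proof (intro conjI allI impI)
    show "countable ?\<B>" using D(1) by auto
    fix U x assume "openin mtopology U \<and> x \<in> U"
    then obtain r where r: "r > 0" "mball x r \<subseteq> U" and x: "x \<in> M"
      by (meson openin_mtopology subsetD)
    obtain n where n: "1 / real (Suc n) < r / 2" using r by (meson half_gt_zero nat_approx_posE)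
    have "1 / real (Suc n) > 0" by simp
    then obtain q where q: "q \<in> D" "q \<in> mball x (1 / real (Suc n))"
      using D(3) x unfolding metric_closure_of by blast
    have "mball q (1 / real (Suc n)) \<subseteq> mball x r"
    proof (rule mball_subset)
      show "d q x + 1 / real (Suc n) \<le> r" using q n by (auto simp: commute)
    qed (rule x)
    then show "\<exists>V\<in>?\<B>. x \<in> V \<and> V \<subseteq> U"
      using q r(2) by (intro bexI[of _ "mball q (1 / real (Suc n))"]) (auto simp: commute)
  qed auto
  then show ?thesis by (auto simp: second_countable_iff_countable_base)
qed

section \<open>Contents on topological spaces\<close>

definition sandwiched :: "'x topology \<Rightarrow> ('x set \<Rightarrow> real) \<Rightarrow> real \<Rightarrow> 'x set \<Rightarrow> bool" where
  "sandwiched T l e E \<longleftrightarrow>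
     (\<exists>C U. closedin T C \<and> openin T U \<and> C \<subseteq> E \<and> E \<subseteq> U \<and> l (U - C) \<le> e)"

lemma sandwichedI:
  "closedin T C \<Longrightarrow> openin T U \<Longrightarrow> C \<subseteq> E \<Longrightarrow> E \<subseteq> U \<Longrightarrow> l (U - C) \<le> e \<Longrightarrow> sandwiched T l e E"
  by (auto simp: sandwiched_def)

definition regular_sets :: "'x topology \<Rightarrow> 'x set set \<Rightarrow> ('x set \<Rightarrow> real) \<Rightarrow> 'x set set" where
  "regular_sets T \<A> l = {E \<in> \<A>. \<forall>e>0. sandwiched T l e E}"

lemma regular_setsD: "E \<in> regular_sets T \<A> l \<Longrightarrow> E \<in> \<A>"
  by (simp add: regular_sets_def)

lemma regular_setsE:
  assumes "E \<in> regular_sets T \<A> l" "e > 0"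
  obtains C U where "closedin T C" "openin T U" "C \<subseteq> E" "E \<subseteq> U" "l (U - C) \<le> e"
  using assms unfolding regular_sets_def sandwiched_def by blast

lemma regular_setsI:
  "E \<in> \<A> \<Longrightarrow> (\<And>e. e > 0 \<Longrightarrow> sandwiched T l e E) \<Longrightarrow> E \<in> regular_sets T \<A> l"
  by (simp add: regular_sets_def)

lemma compact_decseq_subset_finite_UN:
  assumes compact: "compactin T K" and C: "\<And>i. closedin T (C i)" "K \<inter> (\<Inter>i. C i) = {}"
    and decseq: "decseq A" "\<And>i. A i \<subseteq> topspace T"
  shows "\<exists>n. \<forall>m\<ge>n. A m \<subseteq> (topspace T - K) \<union> (\<Union>i\<le>n. A i - C i)"
proof -
  obtain \<F> where \<F>: "finite \<F>" "\<F> \<subseteq> range C" "K \<inter> \<Inter>\<F> = {}"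
    using compact C unfolding compactin_fip by (metis (no_types, lifting) rangeE)
  then obtain J where J: "finite J" "\<F> = C ` J" by (meson finite_subset_image)
  then obtain n where n: "\<And>j. j \<in> J \<Longrightarrow> j \<le> n" using finite_nat_set_iff_bounded_le by auto
  have "A m \<subseteq> (topspace T - K) \<union> (\<Union>i\<le>n. A i - C i)" if "m \<ge> n" for m
  proof
    fix x assume x: "x \<in> A m"
    show "x \<in> (topspace T - K) \<union> (\<Union>i\<le>n. A i - C i)"
    proof (cases "x \<in> K")
      case True
      then obtain j where j: "j \<in> J" "x \<notin> C j" using \<F>(3) J(2) by auto
      moreover have "x \<in> A j"
        using x decseqD[OF decseq(1), of j m] n[OF j(1)] \<open>m \<ge> n\<close> by auto
      ultimately show ?thesis using n by blast
    qed (use x decseq(2) in auto)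
  qed
  then show ?thesis by blast
qed

lemma summable_half_powers: "summable (\<lambda>i. e * (1/2::real) ^ Suc i)"
  and suminf_half_powers: "(\<Sum>i. e * (1/2::real) ^ Suc i) = e"
  using sums_mult[OF power_half_series, of e] by (auto simp: sums_iff)

locale topological_content = algebra "topspace T" \<A>
  for T :: "'x topology" and \<A> :: "'x set set" +
  fixes l :: "'x set \<Rightarrow> real"
  assumes open_sets: "openin T U \<Longrightarrow> U \<in> \<A>"
    and content_nonneg: "E \<in> \<A> \<Longrightarrow> 0 \<le> l E"
    and content_Un_disjoint: "E \<in> \<A> \<Longrightarrow> F \<in> \<A> \<Longrightarrow> E \<inter> F = {} \<Longrightarrow> l (E \<union> F) = l E + l F"
begin

lemma closed_sets: "closedin T C \<Longrightarrow> C \<in> \<A>"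
  using compl_sets[OF open_sets[of "topspace T - C"]] closedin_subset[of T C]
  by (auto simp: closedin_def double_diff)

lemma content_empty: "l {} = 0"
  using content_Un_disjoint[of "{}" "{}"] by simp

lemma content_mono: "E \<in> \<A> \<Longrightarrow> F \<in> \<A> \<Longrightarrow> E \<subseteq> F \<Longrightarrow> l E \<le> l F"
  using content_Un_disjoint[of E "F - E"] content_nonneg[of "F - E"] Diff[of F E]
  by (simp add: Un_absorb1)

lemma content_Un_le:
  assumes "E \<in> \<A>" "F \<in> \<A>"
  shows "l (E \<union> F) \<le> l E + l F"
proof -
  have "l (E \<union> F) = l E + l (F - E)"
    using content_Un_disjoint[of E "F - E"] assms by (simp add: Diff)
  also have "l (F - E) \<le> l F" by (rule content_mono) (use assms in auto)
  finally show ?thesis by simp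
qed

lemma content_UN_le:
  assumes "finite I" "\<And>i. i \<in> I \<Longrightarrow> E i \<in> \<A>"
  shows "l (\<Union>i\<in>I. E i) \<le> (\<Sum>i\<in>I. l (E i))"
  using assms
proof (induction I rule: finite_induct)
  case (insert i I)
  then have "l (E i \<union> (\<Union>i\<in>I. E i)) \<le> l (E i) + l (\<Union>i\<in>I. E i)"
    by (intro content_Un_le finite_UN) auto
  then show ?case using insert by simp
qed (simp add: content_empty)

lemma regular_inner_closed:
  assumes "E \<in> regular_sets T \<A> l" "e > 0"
  obtains C where "closedin T C" "C \<subseteq> E" "l (E - C) \<le> e"
proof -
  obtain C U where CU: "closedin T C" "openin T U" "C \<subseteq> E" "E \<subseteq> U" "l (U - C) \<le> e"
    using assms by (rule regular_setsE)
  moreover have "l (E - C) \<le> l (U - C)"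
    by (intro content_mono Diff CU regular_setsD[OF assms(1)] open_sets[OF CU(2)]
      closed_sets[OF CU(1)] Diff_mono order_refl)
  ultimately show thesis using that by force
qed

lemma algebra_regular_sets: "algebra (topspace T) (regular_sets T \<A> l)"
  unfolding algebra_iff_Un
proof (intro conjI ballI)
  show "regular_sets T \<A> l \<subseteq> Pow (topspace T)" using sets_into_space by (auto dest: regular_setsD)
  show "{} \<in> regular_sets T \<A> l"
    by (rule regular_setsI) (auto simp: content_empty intro!: sandwichedI[of T "{}" "{}"])
next
  fix E assume E: "E \<in> regular_sets T \<A> l"
  show "topspace T - E \<in> regular_sets T \<A> l"
  proof (rule regular_setsI)
    show "topspace T - E \<in> \<A>" using regular_setsD[OF E] by auto
    fix e :: real assume "e > 0"
    with E obtain C U where CU: "closedin T C" "openin T U" "C \<subseteq> E" "E \<subseteq> U" "l (U - C) \<le> e"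
      by (rule regular_setsE)
    have "(topspace T - C) - (topspace T - U) = U - C" using openin_subset[OF CU(2)] by auto
    then show "sandwiched T l e (topspace T - E)"
      using CU by (intro sandwichedI[of T "topspace T - U" "topspace T - C"]) auto
  qed
next
  fix E F assume E: "E \<in> regular_sets T \<A> l" and F: "F \<in> regular_sets T \<A> l"
  show "E \<union> F \<in> regular_sets T \<A> l"
  proof (rule regular_setsI)
    show "E \<union> F \<in> \<A>" using E F by (auto dest: regular_setsD)
    fix e :: real assume e: "e > 0"
    obtain C U where CU: "closedin T C" "openin T U" "C \<subseteq> E" "E \<subseteq> U" "l (U - C) \<le> e/2"
      using regular_setsE[OF E, of "e/2"] e by auto
    obtain C' U' where CU': "closedin T C'" "openin T U'" "C' \<subseteq> F" "F \<subseteq> U'" "l (U' - C') \<le> e/2"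
      using regular_setsE[OF F, of "e/2"] e by auto
    have in_\<A>: "C \<in> \<A>" "U \<in> \<A>" "C' \<in> \<A>" "U' \<in> \<A>"
      using CU CU' by (auto intro: open_sets closed_sets)
    have "l ((U \<union> U') - (C \<union> C')) \<le> l ((U - C) \<union> (U' - C'))"
      by (rule content_mono) (use in_\<A> in auto)
    also have "\<dots> \<le> l (U - C) + l (U' - C')" by (rule content_Un_le) (use in_\<A> in auto)
    finally show "sandwiched T l e (E \<union> F)"
      using CU CU' by (intro sandwichedI[of T "C \<union> C'" "U \<union> U'"]) auto
  qed
qed

end

locale tight_content = topological_content +
  assumes tight: "e > 0 \<Longrightarrow> \<exists>K. compactin T K \<and> closedin T K \<and> l (topspace T - K) \<le> e"
begin

lemma decseq_regular_tendsto_0: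
  assumes reg: "range A \<subseteq> regular_sets T \<A> l" and dec: "decseq A" and INT: "(\<Inter>i. A i) = {}"
  shows "(\<lambda>i. l (A i)) \<longlonglongrightarrow> 0"
proof (rule LIMSEQ_I)
  fix e :: real assume e: "e > 0"
  have A: "A i \<in> \<A>" for i using reg by (auto dest: regular_setsD)
  obtain K where K: "compactin T K" "closedin T K" "l (topspace T - K) \<le> e/4"
    using tight[of "e/4"] e by auto
  have "\<exists>C. closedin T C \<and> C \<subseteq> A i \<and> l (A i - C) \<le> (e/4) * (1/2) ^ Suc i" for i
  proof -
    have "A i \<in> regular_sets T \<A> l" "(e/4) * (1/2) ^ Suc i > 0" using reg e by auto
    then show ?thesis by (rule regular_inner_closed) blast
  qed
  then obtain C where C: "\<And>i. closedin T (C i)" "\<And>i. C i \<subseteq> A i"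
    "\<And>i. l (A i - C i) \<le> (e/4) * (1/2) ^ Suc i"
    by metis
  have "K \<inter> (\<Inter>i. C i) = {}" using INT C(2) by blast
  from compact_decseq_subset_finite_UN[OF K(1) C(1) this dec sets_into_space[OF A]]
  obtain n where n: "\<forall>m\<ge>n. A m \<subseteq> (topspace T - K) \<union> (\<Union>i\<le>n. A i - C i)" ..
  have in_\<A>: "topspace T - K \<in> \<A>" "A i - C i \<in> \<A>" for i
    by (intro compl_sets Diff A closed_sets K(2) C(1))+
  have "l (A m) < e" if "m \<ge> n" for m
  proof -
    have "l (A m) \<le> l ((topspace T - K) \<union> (\<Union>i\<le>n. A i - C i))"
      by (intro content_mono n[rule_format, OF that] A Un finite_UN in_\<A>) simp
    also have "\<dots> \<le> l (topspace T - K) + l (\<Union>i\<le>n. A i - C i)"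
      by (intro content_Un_le finite_UN in_\<A>) simp
    also have "l (\<Union>i\<le>n. A i - C i) \<le> (\<Sum>i\<le>n. l (A i - C i))"
      by (intro content_UN_le in_\<A>) simp
    also have "\<dots> \<le> (\<Sum>i\<le>n. (e/4) * (1/2) ^ Suc i)" by (intro sum_mono C(3))
    also have "\<dots> \<le> (\<Sum>i. (e/4) * (1/2) ^ Suc i)"
      by (rule sum_le_suminf[OF summable_half_powers]) (use e in auto)
    also have "\<dots> = e/4" by (rule suminf_half_powers)
    finally show ?thesis using K(3) e by simp
  qed
  then show "\<exists>n. \<forall>m\<ge>n. norm (l (A m) - 0) < e" using content_nonneg[OF A] by auto
qed

lemma regular_measure_extension:
  obtains Q where "space Q = topspace T" "sets Q = sigma_sets (topspace T) (regular_sets T \<A> l)"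
    "\<And>E. E \<in> regular_sets T \<A> l \<Longrightarrow> emeasure Q E = ennreal (l E)"
proof -
  let ?R = "regular_sets T \<A> l"
  interpret R: algebra "topspace T" ?R by (rule algebra_regular_sets)
  have "\<exists>\<nu>. (\<forall>E\<in>?R. \<nu> E = ennreal (l E)) \<and> measure_space (topspace T) (sigma_sets (topspace T) ?R) \<nu>"
  proof (rule R.caratheodory_empty_continuous)
    show "positive ?R (\<lambda>E. ennreal (l E))" by (simp add: positive_def content_empty)
    show "Measure_Space.additive ?R (\<lambda>E. ennreal (l E))"
      by (auto simp: Measure_Space.additive_def content_Un_disjoint ennreal_plus content_nonneg
        dest!: regular_setsD)
    show "(\<lambda>i. ennreal (l (A i))) \<longlonglongrightarrow> 0" if "range A \<subseteq> ?R" "decseq A" "(\<Inter>i. A i) = {}" for A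
      using tendsto_ennrealI[OF decseq_regular_tendsto_0[OF that]] by simp
  qed simp
  then obtain \<nu> where \<nu>: "\<And>E. E \<in> ?R \<Longrightarrow> \<nu> E = ennreal (l E)"
    "measure_space (topspace T) (sigma_sets (topspace T) ?R) \<nu>" by blast
  show thesis
  proof (rule that)
    let ?Q = "measure_of (topspace T) ?R \<nu>"
    show "space ?Q = topspace T" by (rule space_measure_of[OF R.space_closed])
    show sets: "sets ?Q = sigma_sets (topspace T) ?R" by (rule sets_measure_of[OF R.space_closed])
    show "emeasure ?Q E = ennreal (l E)" if "E \<in> ?R" for E
      using emeasure_measure_of[OF refl R.space_closed, of \<nu> E] \<nu> that
      by (simp add: sets measure_space_def)
  qed
qed

lemma extension_open_le:
  assumes base: "countable_base T \<B>" "\<B> \<subseteq> regular_sets T \<A> l"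
    and regular_sub: "regular_sets T \<A> l \<subseteq> sets Q"
    and extends: "\<And>E. E \<in> regular_sets T \<A> l \<Longrightarrow> emeasure Q E = ennreal (l E)"
    and W: "openin T W"
  shows "emeasure Q W \<le> ennreal (l W)"
proof -
  interpret R: algebra "topspace T" "regular_sets T \<A> l" by (rule algebra_regular_sets)
  let ?\<V> = "insert {} {V\<in>\<B>. V \<subseteq> W}"
  define V where "V = from_nat_into ?\<V>"
  have range_V: "range V = ?\<V>"
    unfolding V_def using countable_baseD(1)[OF base(1)] by (intro range_from_nat_into) auto
  then have V_cases: "V i = {} \<or> V i \<in> \<B> \<and> V i \<subseteq> W" for i by auto
  have V: "V i \<in> regular_sets T \<A> l" "V i \<subseteq> W" for i using V_cases[of i] base(2) by auto
  have "(\<lambda>n. emeasure Q (\<Union>i<n. V i)) \<longlonglongrightarrow> emeasure Q (\<Union>n. \<Union>i<n. V i)"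
    by (rule Lim_emeasure_incseq)
      (use V(1) regular_sub in \<open>auto simp: incseq_def intro: less_le_trans\<close>)
  moreover have "(\<Union>n. \<Union>i<n. V i) = \<Union>(range V)" by auto
  moreover have "\<Union>(range V) = W" using range_V countable_base_Union[OF base(1) W] by simp
  moreover have "emeasure Q (\<Union>i<n. V i) \<le> ennreal (l W)" for n
  proof -
    have reg: "(\<Union>i<n. V i) \<in> regular_sets T \<A> l" by (intro R.finite_UN V(1)) simp
    have "l (\<Union>i<n. V i) \<le> l W"
      by (intro content_mono regular_setsD[OF reg] open_sets W UN_least V(2))
    then show ?thesis using extends[OF reg] by (simp add: ennreal_leI)
  qed
  ultimately show ?thesis using LIMSEQ_le_const2 by (metis (no_types, lifting))
qed

theorem borel_measure_extension:
  assumes base: "countable_base T \<B>" "\<B> \<subseteq> regular_sets T \<A> l"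
  obtains P where "sets P = sets (borel_of T)"
    "\<And>E. E \<in> regular_sets T \<A> l \<Longrightarrow> E \<in> sets (borel_of T) \<Longrightarrow> emeasure P E = ennreal (l E)"
    "\<And>W. openin T W \<Longrightarrow> emeasure P W \<le> ennreal (l W)"
proof -
  obtain Q where Q: "space Q = topspace T" "sets Q = sigma_sets (topspace T) (regular_sets T \<A> l)"
    "\<And>E. E \<in> regular_sets T \<A> l \<Longrightarrow> emeasure Q E = ennreal (l E)"
    using regular_measure_extension by metis
  have regular_sub: "regular_sets T \<A> l \<subseteq> sets Q" unfolding Q(2) by auto
  have borel: "subalgebra Q (borel_of T)"
    using borel_of_subset_sets[OF base(1)] base(2) regular_sub Q(1) by (auto simp: subalgebra_def)
  show thesis
    by (rule that[of "restr_to_subalg Q (borel_of T)"])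
      (simp_all add: sets_restr_to_subalg[OF borel] emeasure_restr_to_subalg[OF borel] Q(3)
        extension_open_le[OF base regular_sub Q(3)] borel_of_open)
qed

end

section \<open>Finite Borel measures\<close>

context finite_measure
begin

lemma topological_content_measure:
  assumes "sets M = sets (borel_of T)"
  shows "topological_content T (sets M) (measure M)"
proof -
  have "space M = topspace T" using sets_eq_imp_space_eq[OF assms] by simp
  then interpret algebra "topspace T" "sets M" using sets.algebra_axioms[of M] by simp
  show ?thesis
    by unfold_locales (auto simp: assms borel_of_open finite_measure_Union)
qed

lemma measure_UN_tail_le:
  assumes A_sets: "\<And>i::nat. A i \<in> sets M" and e_pos: "e > 0"
  obtains n where "measure M ((\<Union>i. A i) - (\<Union>i<n. A i)) \<le> e"
proof -
  have "(\<lambda>n. measure M (\<Union>i<n. A i)) \<longlonglongrightarrow> measure M (\<Union>n. \<Union>i<n. A i)"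
    by (rule finite_Lim_measure_incseq) (use A_sets in \<open>auto simp: incseq_def intro: less_le_trans\<close>)
  moreover have "(\<Union>n. \<Union>i<n. A i) = (\<Union>i. A i)" by auto
  ultimately obtain n where n: "\<bar>measure M (\<Union>i<n. A i) - measure M (\<Union>i. A i)\<bar> < e"
    using e_pos LIMSEQ_D[of _ "measure M (\<Union>i. A i)" e] by fastforce
  have "measure M ((\<Union>i. A i) - (\<Union>i<n. A i)) = measure M (\<Union>i. A i) - measure M (\<Union>i<n. A i)"
    by (rule finite_measure_Diff) (use A_sets in auto)
  then show thesis using n by (intro that[of n]) linarith
qed

lemma measure_UN_half_powers_le:
  assumes A_sets: "\<And>i. A i \<in> sets M" and measure_le: "\<And>i. measure M (A i) \<le> e * (1/2) ^ Suc i"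
  shows "measure M (\<Union>i. A i) \<le> e"
proof -
  have summable: "summable (\<lambda>i. measure M (A i))"
    by (rule summable_comparison_test'[OF summable_half_powers, of 0]) (use measure_le in auto)
  have "measure M (\<Union>i. A i) \<le> (\<Sum>i. measure M (A i))"
    by (rule finite_measure_subadditive_countably) (use A_sets summable in auto)
  also have "\<dots> \<le> (\<Sum>i. e * (1/2) ^ Suc i)"
    by (rule suminf_le[OF measure_le summable summable_half_powers])
  also have "\<dots> = e" by (rule suminf_half_powers)
  finally show ?thesis .
qed

lemma regular_sets_UN:
  assumes sets: "sets M = sets (borel_of T)"
    and A_regular: "\<And>i::nat. A i \<in> regular_sets T (sets M) (measure M)"
  shows "(\<Union>i. A i) \<in> regular_sets T (sets M) (measure M)"
proof (rule regular_setsI)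
  show "(\<Union>i. A i) \<in> sets M" using A_regular by (auto dest: regular_setsD)
  fix e :: real assume "e > 0"
  then have "sandwiched T (measure M) ((e/2) * (1/2) ^ Suc i) (A i)" for i
    using A_regular[of i] by (simp add: regular_sets_def)
  then obtain C U where C: "\<And>i. closedin T (C i)" "\<And>i. C i \<subseteq> A i"
    and U: "\<And>i. openin T (U i)" "\<And>i. A i \<subseteq> U i"
    and gap_le: "\<And>i. measure M (U i - C i) \<le> (e/2) * (1/2) ^ Suc i"
    unfolding sandwiched_def by metis
  have C_sets: "C i \<in> sets M" and U_sets: "U i \<in> sets M" for i
    using C U by (simp_all add: sets borel_of_open borel_of_closed)
  obtain n where n: "measure M ((\<Union>i. C i) - (\<Union>i<n. C i)) \<le> e/2"
    using measure_UN_tail_le[of C "e/2"] C_sets \<open>e > 0\<close> by auto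
  have "measure M ((\<Union>i. U i) - (\<Union>i<n. C i)) \<le> measure M ((\<Union>i. U i - C i) \<union> ((\<Union>i. C i) - (\<Union>i<n. C i)))"
    by (rule finite_measure_mono) (use C_sets U_sets in auto)
  also have "\<dots> \<le> measure M (\<Union>i. U i - C i) + measure M ((\<Union>i. C i) - (\<Union>i<n. C i))"
    by (rule measure_Un_le) (use C_sets U_sets in auto)
  also have "measure M (\<Union>i. U i - C i) \<le> e/2"
    by (rule measure_UN_half_powers_le) (use C_sets U_sets gap_le in auto)
  finally have "measure M ((\<Union>i. U i) - (\<Union>i<n. C i)) \<le> e" using n by linarith
  moreover have "closedin T (\<Union>i<n. C i)" using C(1) by (intro closedin_Union) auto
  ultimately show "sandwiched T (measure M) e (\<Union>i. A i)"
    using C(2) U by (intro sandwichedI[of T "\<Union>i<n. C i" "\<Union>i. U i"]) blast+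
qed

lemma open_regular:
  assumes metrizable: "metrizable_space T" and sets: "sets M = sets (borel_of T)"
    and U: "openin T U"
  shows "U \<in> regular_sets T (sets M) (measure M)"
proof (rule regular_setsI)
  show "U \<in> sets M" using U by (simp add: sets borel_of_open)
  fix e :: real assume "e > 0"
  obtain C where C: "\<And>n::nat. closedin T (C n)" "(\<Union>i. C i) = U"
    using open_imp_fsigma_in[OF metrizable U] unfolding fsigma_in_ascending by blast
  obtain n where "measure M ((\<Union>i. C i) - (\<Union>i<n. C i)) \<le> e"
    using measure_UN_tail_le[of C e] C(1) \<open>e > 0\<close> by (auto simp: sets borel_of_closed)
  moreover have "closedin T (\<Union>i<n. C i)" using C(1) by (intro closedin_Union) auto
  ultimately show "sandwiched T (measure M) e U"
    using C(2) U by (intro sandwichedI[of T "\<Union>i<n. C i" U]) blast+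
qed

theorem regular_sets_borel:
  assumes metrizable: "metrizable_space T" and sets: "sets M = sets (borel_of T)"
  shows "regular_sets T (sets M) (measure M) = sets M"
proof
  interpret topological_content T "sets M" "measure M"
    by (rule topological_content_measure[OF sets])
  interpret R: sigma_algebra "topspace T" "regular_sets T (sets M) (measure M)"
    unfolding sigma_algebra_iff using algebra_regular_sets regular_sets_UN[OF sets] by blast
  have "sigma_sets (topspace T) {U. openin T U} \<subseteq> regular_sets T (sets M) (measure M)"
    by (intro R.sigma_sets_subset) (auto intro: open_regular[OF metrizable sets])
  then show "sets M \<subseteq> regular_sets T (sets M) (measure M)" by (simp only: sets sets_borel_of)
qed (auto dest: regular_setsD)

end

definition polish_topology :: "'x topology \<Rightarrow> bool" where
  "polish_topology T \<longleftrightarrow> completely_metrizable_space T \<and> second_countable T"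

lemma polish_topology_imp_metrizable: "polish_topology T \<Longrightarrow> metrizable_space T"
  by (simp add: polish_topology_def completely_metrizable_imp_metrizable_space)

lemma polish_topology_imp_Hausdorff: "polish_topology T \<Longrightarrow> Hausdorff_space T"
  by (simp add: polish_topology_imp_metrizable metrizable_imp_Hausdorff_space)

lemma polish_topology_mtopology_of:
  assumes "mcomplete_of m" "separable_space (mtopology_of m)"
  shows "polish_topology (mtopology_of m)"
proof -
  interpret Metric_space "mspace m" "mdist m" by simp
  show ?thesis
    using assms completely_metrizable_space_mtopology separable_imp_second_countable
    by (simp add: polish_topology_def mtopology_of_def mcomplete_of_def)
qed

lemma polish_topology_product_topology:
  assumes "finite I" "\<And>i. i \<in> I \<Longrightarrow> polish_topology (X i)"
  shows "polish_topology (product_topology X I)"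
proof -
  obtain \<B> where "\<And>i. i \<in> I \<Longrightarrow> countable_base (X i) (\<B> i)"
    using assms(2) unfolding polish_topology_def second_countable_iff_countable_base by metis
  then have "countable_base (product_topology X I) (PiE I ` PiE I \<B>)"
    by (rule countable_base_PiE[OF assms(1)])
  then have "second_countable (product_topology X I)"
    unfolding second_countable_iff_countable_base ..
  moreover have "completely_metrizable_space (product_topology X I)"
    using assms by
      (auto simp: completely_metrizable_space_product_topology polish_topology_def countable_finite)
  ultimately show ?thesis by (simp add: polish_topology_def)
qed

lemma (in Metric_space) mtotally_bounded_if_finite_mcball_covers:
  assumes subset: "K \<subseteq> M" and cover: "\<And>\<epsilon>. \<epsilon> > 0 \<Longrightarrow> \<exists>Q. finite Q \<and> K \<subseteq> (\<Union>q\<in>Q. mcball q \<epsilon>)"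
  shows "mtotally_bounded K"
  unfolding mtotally_bounded_def
proof (intro allI impI)
  fix \<epsilon> :: real assume "\<epsilon> > 0"
  then obtain Q where Q: "finite Q" "K \<subseteq> (\<Union>q\<in>Q. mcball q (\<epsilon>/3))" using cover[of "\<epsilon>/3"] by auto
  let ?Q = "{q\<in>Q. K \<inter> mcball q (\<epsilon>/3) \<noteq> {}}"
  have "\<forall>q\<in>?Q. \<exists>x. x \<in> K \<inter> mcball q (\<epsilon>/3)" by blast
  from bchoice[OF this] obtain f where "\<forall>q\<in>?Q. f q \<in> K \<inter> mcball q (\<epsilon>/3)" ..
  note f = this[rule_format]
  have cover_f: "x \<in> (\<Union>y\<in>f ` ?Q. mball y \<epsilon>)" if x: "x \<in> K" for x
  proof -
    obtain q where q: "q \<in> ?Q" "x \<in> mcball q (\<epsilon>/3)" using Q(2) x by blast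
    have "d (f q) x \<le> d (f q) q + d q x" by (rule triangle) (use f[OF q(1)] q in auto)
    also have "\<dots> < \<epsilon>" using f[OF q(1)] q(2) \<open>\<epsilon> > 0\<close> by (auto simp: commute)
    finally have "x \<in> mball (f q) \<epsilon>" using f[OF q(1)] x subset by auto
    then show ?thesis using q(1) by blast
  qed
  show "\<exists>K'. finite K' \<and> K' \<subseteq> K \<and> K \<subseteq> (\<Union>x\<in>K'. mball x \<epsilon>)"
  proof (intro exI conjI subsetI)
    show "finite (f ` ?Q)" using Q(1) by simp
    show "x \<in> K" if "x \<in> f ` ?Q" for x using that f by blast
  qed (rule cover_f)
qed

lemma (in Metric_space) closedin_Int_UN_mcball:
  assumes "finite Q"
  shows "closedin mtopology (M \<inter> (\<Union>q\<in>Q. mcball q r))"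
  using assms closedin_topspace[of mtopology] by (intro closedin_Int closedin_Union) auto

lemma (in Metric_space) compactin_INT_finite_mcball_covers:
  assumes mcomplete and finite: "\<And>n. finite (Q n)"
  shows "compactin mtopology (\<Inter>n. M \<inter> (\<Union>q\<in>Q n. mcball q (1 / real (Suc n))))" (is "compactin _ ?K")
proof -
  have "mtotally_bounded ?K"
  proof (rule mtotally_bounded_if_finite_mcball_covers)
    fix \<epsilon> :: real assume "\<epsilon> > 0"
    then obtain n where n: "1 / real (Suc n) < \<epsilon>" by (meson nat_approx_posE)
    have "?K \<subseteq> (\<Union>q\<in>Q n. mcball q (1 / real (Suc n)))" by blast
    also have "\<dots> \<subseteq> (\<Union>q\<in>Q n. mcball q \<epsilon>)" using n by (intro UN_mono mcball_subset_concentric) auto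
    finally show "\<exists>Q. finite Q \<and> ?K \<subseteq> (\<Union>q\<in>Q. mcball q \<epsilon>)" using finite by blast
  qed blast
  moreover have "closedin mtopology ?K" by (intro closedin_INT closedin_Int_UN_mcball finite) simp
  ultimately show ?thesis
    using mtotally_bounded_eq_compact_closure_of[OF \<open>mcomplete\<close>, of ?K]
    by (simp only: closure_of_closedin)
qed

context finite_measure
begin

lemma finite_mcball_cover_of_most:
  assumes "Metric_space S d" and sets: "sets M = sets (borel_of (Metric_space.mtopology S d))"
    and separable: "separable_space (Metric_space.mtopology S d)" and r_pos: "r > 0"
    and e_pos: "e > 0"
  obtains Q where "finite Q" "measure M (S - (\<Union>q\<in>Q. Metric_space.mcball S d q r)) \<le> e"
proof -
  interpret Metric_space S d by fact
  obtain D where D: "countable D" "D \<subseteq> S" "mtopology closure_of D = S"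
    using separable unfolding separable_space_def by auto
  let ?q = "from_nat_into D"
  have "S \<subseteq> (\<Union>i. mcball (?q i) r)"
  proof
    fix x assume "x \<in> S"
    then obtain y where y: "y \<in> D" "y \<in> mball x r"
      using D(3) r_pos unfolding metric_closure_of by blast
    then obtain i where "?q i = y" using from_nat_into_surj[OF D(1)] by blast
    then show "x \<in> (\<Union>i. mcball (?q i) r)" using y by (auto simp: commute)
  qed
  then have cover: "(\<Union>i. mcball (?q i) r) = S" by auto
  have "mcball (?q i) r \<in> sets M" for i by (simp add: sets borel_of_closed)
  then obtain n where "measure M ((\<Union>i. mcball (?q i) r) - (\<Union>i<n. mcball (?q i) r)) \<le> e"
    using measure_UN_tail_le[of "\<lambda>i. mcball (?q i) r"] e_pos by blast
  then show thesis by (intro that[of "?q ` {..<n}"]) (simp_all add: cover)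
qed

theorem borel_tight:
  assumes polish: "polish_topology T" and sets: "sets M = sets (borel_of T)" and e_pos: "e > 0"
  obtains K where "compactin T K" "measure M (topspace T - K) \<le> e"
proof -
  obtain S d where S: "Metric_space S d" "Metric_space.mcomplete S d"
    "T = Metric_space.mtopology S d"
    using polish unfolding polish_topology_def completely_metrizable_space_def by blast
  interpret Metric_space S d by fact
  have separable: "separable_space mtopology"
    using polish unfolding polish_topology_def S(3)
    by (blast intro: second_countable_imp_separable_space)
  have pos: "1 / real (Suc n) > 0" "e * (1/2) ^ Suc n > 0" for n using e_pos by simp_all
  have "\<exists>Q. finite Q \<and> measure M (S - (\<Union>q\<in>Q. mcball q (1 / real (Suc n)))) \<le> e * (1/2) ^ Suc n"
    for n
    by (rule finite_mcball_cover_of_most[OF S(1) sets[unfolded S(3)] separable pos]) blast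
  then obtain Q where Q: "\<And>n. finite (Q n)"
    "\<And>n. measure M (S - (\<Union>q\<in>Q n. mcball q (1 / real (Suc n)))) \<le> e * (1/2) ^ Suc n"
    by metis
  let ?F = "\<lambda>n. S \<inter> (\<Union>q\<in>Q n. mcball q (1 / real (Suc n)))"
  have "measure M (\<Union>n. S - ?F n) \<le> e"
  proof (rule measure_UN_half_powers_le)
    have "closedin T (?F n)" for n
      unfolding S(3) using Q(1) by (rule closedin_Int_UN_mcball)
    then show "S - ?F n \<in> sets M" for n by (auto simp: sets S(3) closedin_def intro: borel_of_open)
    show "measure M (S - ?F n) \<le> e * (1/2) ^ Suc n" for n
      using Q(2)[of n] by (simp only: Diff_Int Diff_cancel Un_empty_left)
  qed
  moreover have "topspace T - (\<Inter>n. ?F n) = (\<Union>n. S - ?F n)"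
    unfolding S(3) topspace_mtopology by blast
  moreover have "compactin T (\<Inter>n. ?F n)"
    unfolding S(3) by (rule compactin_INT_finite_mcball_covers[OF S(2) Q(1)])
  ultimately show thesis using that by simp
qed

lemma compact_inner_approximation:
  assumes polish: "polish_topology T" and sets: "sets M = sets (borel_of T)"
    and A_sets: "A \<in> sets M" and e_pos: "e > 0"
  obtains K where "compactin T K" "K \<subseteq> A" "measure M (A - K) \<le> e"
proof -
  interpret topological_content T "sets M" "measure M"
    by (rule topological_content_measure[OF sets])
  have "A \<in> regular_sets T (sets M) (measure M)"
    using A_sets regular_sets_borel[OF polish_topology_imp_metrizable[OF polish] sets] by simp
  then obtain C where C: "closedin T C" "C \<subseteq> A" "measure M (A - C) \<le> e/2"
    using regular_inner_closed[of A "e/2"] e_pos by auto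
  obtain K where K: "compactin T K" "measure M (topspace T - K) \<le> e/2"
    using borel_tight[OF polish sets, of "e/2"] e_pos by auto
  have K_closed: "closedin T K"
    by (rule compactin_imp_closedin[OF polish_topology_imp_Hausdorff[OF polish] K(1)])
  have in_M: "A - C \<in> sets M" "topspace T - K \<in> sets M" "C \<inter> K \<in> sets M"
    using A_sets closed_sets[OF C(1)] closed_sets[OF K_closed] by auto
  have "A - C \<inter> K \<subseteq> (A - C) \<union> (topspace T - K)" using sets_into_space[OF A_sets] by auto
  then have "measure M (A - C \<inter> K) \<le> measure M ((A - C) \<union> (topspace T - K))"
    by (rule finite_measure_mono) (use in_M in auto)
  also have "\<dots> \<le> measure M (A - C) + measure M (topspace T - K)"
    by (rule measure_Un_le) (use in_M in auto)
  finally have "measure M (A - C \<inter> K) \<le> e" using C K by linarith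
  moreover have "compactin T (C \<inter> K)" by (rule closed_Int_compactin[OF C(1) K(1)])
  ultimately show thesis using C(2) by (intro that[of "C \<inter> K"]) auto
qed

lemma AE_in_sigma_compact:
  assumes polish: "polish_topology T" and sets: "sets M = sets (borel_of T)"
    and AE_Q: "AE x in M. Q x"
  obtains K where "\<And>n::nat. compactin T (K n)" "\<And>n x. x \<in> K n \<Longrightarrow> Q x" "AE x in M. x \<in> (\<Union>n. K n)"
proof -
  obtain Z where Z: "{x \<in> space M. \<not> Q x} \<subseteq> Z" "Z \<in> null_sets M" using AE_Q by (auto elim!: AE_E)
  define A where "A = space M - Z"
  have A: "A \<in> sets M" using Z(2) by (auto simp: A_def)
  have "\<exists>K. compactin T K \<and> K \<subseteq> A \<and> measure M (A - K) \<le> 1 / real (Suc n)" for n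
    by (rule compact_inner_approximation[OF polish sets A, of "1 / real (Suc n)"]) auto
  then obtain K where K: "\<And>n. compactin T (K n)" "\<And>n. K n \<subseteq> A"
    "\<And>n. measure M (A - K n) \<le> 1 / real (Suc n)"
    by metis
  have K_sets: "K n \<in> sets M" for n
    using compactin_imp_closedin[OF polish_topology_imp_Hausdorff[OF polish] K(1)]
    by (simp add: sets borel_of_closed)
  have "measure M (A - (\<Union>n. K n)) \<le> 1 / real (Suc n)" for n
    using finite_measure_mono[of "A - (\<Union>n. K n)" "A - K n"] A K_sets K(3)[of n] by force
  then have "measure M (A - (\<Union>n. K n)) \<le> 0"
    by (meson dual_order.strict_trans1 linorder_not_le nat_approx_posE)
  then have "A - (\<Union>n. K n) \<in> null_sets M"
    using A K_sets by (auto simp: null_sets_def emeasure_eq_measure intro!: antisym)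
  then have "AE x in M. x \<notin> Z \<union> (A - (\<Union>n. K n))" by (intro AE_not_in null_sets.Un Z(2))
  then have "AE x in M. x \<in> (\<Union>n. K n)" using AE_space by eventually_elim (auto simp: A_def)
  moreover have "Q x" if "x \<in> K n" for n x using K(2)[of n] Z(1) that by (auto simp: A_def)
  ultimately show thesis using K(1) by (intro that[of K])
qed

text \<open>A continuous image of a Borel set need not be Borel, hence the detour through compact sets.\<close>

lemma AE_distr_continuous_image:
  assumes polish: "polish_topology T" and sets: "sets M = sets (borel_of T)"
    and AE_Q: "AE x in M. Q x"
    and continuous: "continuous_map T T' f" and Hausdorff: "Hausdorff_space T'"
    and sets_N: "sets N = sets (borel_of T')"
  shows "AE z in distr M N f. \<exists>x\<in>topspace T. Q x \<and> f x = z"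
proof -
  obtain K where K: "\<And>n::nat. compactin T (K n)" "\<And>n x. x \<in> K n \<Longrightarrow> Q x" "AE x in M. x \<in> (\<Union>n. K n)"
    using AE_in_sigma_compact[OF polish sets AE_Q] by metis
  have meas: "f \<in> M \<rightarrow>\<^sub>M N"
    using continuous_map_borel_measurable[OF continuous]
    by (simp add: measurable_cong_sets[OF sets sets_N])
  have "f ` K n \<in> sets N" for n
    unfolding sets_N by (intro borel_of_closed compactin_imp_closedin[OF Hausdorff]
      image_compactin[OF K(1) continuous])
  then have "{z \<in> space N. z \<in> (\<Union>n. f ` K n)} \<in> sets N" by measurable
  moreover have "AE x in M. f x \<in> (\<Union>n. f ` K n)" using K(3) by eventually_elim blast
  ultimately have "AE z in distr M N f. z \<in> (\<Union>n. f ` K n)" by (simp add: AE_distr_iff[OF meas])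
  then show ?thesis
  proof eventually_elim
    case (elim z)
    then show ?case using K(2) compactin_subset_topspace[OF K(1)] by blast
  qed
qed

end

section \<open>Integrals of layer sums\<close>

definition layer_sum :: "real \<Rightarrow> nat \<Rightarrow> real \<Rightarrow> real" where
  "layer_sum h K y = (\<Sum>i\<in>{1..K}. h * indicator {real i * h <..} y)"

lemma layer_sum_bounds:
  assumes "h > 0" "y \<ge> 0"
  shows "layer_sum h K y \<le> y" and "min y (real K * h) - h \<le> layer_sum h K y"
proof -
  have "(real K * h < y \<and> layer_sum h K y = real K * h) \<or>
      (y \<le> real K * h \<and> y - h \<le> layer_sum h K y \<and> layer_sum h K y \<le> y)"
  proof (induction K)
    case 0
    show ?case using assms by (auto simp: layer_sum_def)
  next
    case (Suc K)
    have "layer_sum h (Suc K) y = layer_sum h K y + h * indicator {real (Suc K) * h <..} y"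
      by (simp add: layer_sum_def)
    moreover have "real (Suc K) * h = real K * h + h" by (simp add: algebra_simps)
    ultimately show ?case using Suc assms(1) by (auto simp: indicator_def)
  qed
  then show "layer_sum h K y \<le> y" "min y (real K * h) - h \<le> layer_sum h K y"
    using assms(1) by (smt (verit))+
qed

lemma layer_sum_tendsto:
  assumes nonneg: "y \<ge> 0"
  shows "(\<lambda>n. layer_sum (1 / real (Suc n)) (Suc n * Suc n) y) \<longlonglongrightarrow> y"
proof (rule tendsto_sandwich)
  have step_pos: "1 / real (Suc n) > 0" for n by simp
  show "\<forall>\<^sub>F n in sequentially. layer_sum (1 / real (Suc n)) (Suc n * Suc n) y \<le> y"
    by (intro always_eventually allI layer_sum_bounds(1)[OF step_pos nonneg])
  obtain n0 :: nat where n0: "y \<le> real n0" using real_arch_simple by blast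
  show "\<forall>\<^sub>F n in sequentially. y - 1 / real (Suc n) \<le> layer_sum (1 / real (Suc n)) (Suc n * Suc n) y"
    using eventually_ge_at_top[of n0]
  proof eventually_elim
    case (elim n)
    have "real (Suc n * Suc n) * (1 / real (Suc n)) = real (Suc n)" by (simp add: field_simps)
    with layer_sum_bounds(2)[OF step_pos[of n] nonneg, of "Suc n * Suc n"] show ?case
      using n0 elim by simp
  qed
  show "(\<lambda>n. y - 1 / real (Suc n)) \<longlonglongrightarrow> y"
    using tendsto_diff[OF tendsto_const LIMSEQ_Suc[OF lim_1_over_n], of y] by simp
qed simp

lemma nn_integral_layer_sum:
  assumes [measurable]: "f \<in> borel_measurable M" and h_pos: "h > 0"
  shows "(\<integral>\<^sup>+ x. ennreal (layer_sum h K (f x)) \<partial>M) =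
    (\<Sum>i\<in>{1..K}. ennreal h * emeasure M {x \<in> space M. real i * h < f x})"
proof -
  have layer_sum_eq: "ennreal (layer_sum h K (f x)) =
      (\<Sum>i\<in>{1..K}. ennreal h * indicator {x \<in> space M. real i * h < f x} x)" if "x \<in> space M" for x
  proof -
    have "ennreal (layer_sum h K (f x)) = (\<Sum>i\<in>{1..K}. ennreal (h * indicator {real i * h <..} (f x)))"
      unfolding layer_sum_def by (rule sum_ennreal[symmetric]) (use h_pos in simp)
    also have "\<dots> = (\<Sum>i\<in>{1..K}. ennreal h * indicator {x \<in> space M. real i * h < f x} x)"
      using that by (intro sum.cong) (simp_all add: indicator_def)
    finally show ?thesis .
  qed
  have "(\<integral>\<^sup>+ x. ennreal (layer_sum h K (f x)) \<partial>M) =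
      (\<integral>\<^sup>+ x. (\<Sum>i\<in>{1..K}. ennreal h * indicator {x \<in> space M. real i * h < f x} x) \<partial>M)"
    by (rule nn_integral_cong) (rule layer_sum_eq)
  also have "\<dots> = (\<Sum>i\<in>{1..K}. \<integral>\<^sup>+ x. ennreal h * indicator {x \<in> space M. real i * h < f x} x \<partial>M)"
    by (rule nn_integral_sum) measurable
  also have "\<dots> = (\<Sum>i\<in>{1..K}. ennreal h * emeasure M {x \<in> space M. real i * h < f x})"
    by (intro sum.cong refl nn_integral_cmult_indicator) measurable
  finally show ?thesis .
qed

lemma nn_integral_le_of_layer_sums_le:
  fixes f :: "'x \<Rightarrow> real"
  assumes f_measurable[measurable]: "f \<in> borel_measurable M" and nonneg: "\<And>x. x \<in> space M \<Longrightarrow> 0 \<le> f x"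
    and layer_sums_le:
      "\<And>h K. h > 0 \<Longrightarrow> (\<Sum>i\<in>{1..K}. ennreal h * emeasure M {x \<in> space M. real i * h < f x}) \<le> C"
  shows "(\<integral>\<^sup>+ x. ennreal (f x) \<partial>M) \<le> C"
proof -
  define s where "s n x = layer_sum (1 / real (Suc n)) (Suc n * Suc n) (f x)" for n x
  have [measurable]: "s n \<in> borel_measurable M" for n
    unfolding s_def layer_sum_def by measurable
  have s_le: "(\<integral>\<^sup>+ x. ennreal (s n x) \<partial>M) \<le> C" for n
  proof -
    have "1 / real (Suc n) > 0" by simp
    then show ?thesis
      unfolding s_def nn_integral_layer_sum[OF f_measurable \<open>1 / real (Suc n) > 0\<close>]
      by (rule layer_sums_le)
  qed
  have "(\<integral>\<^sup>+ x. ennreal (f x) \<partial>M) = (\<integral>\<^sup>+ x. liminf (\<lambda>n. ennreal (s n x)) \<partial>M)"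
  proof (rule nn_integral_cong)
    fix x assume "x \<in> space M"
    then have "(\<lambda>n. ennreal (s n x)) \<longlonglongrightarrow> ennreal (f x)"
      unfolding s_def by (intro tendsto_ennrealI layer_sum_tendsto nonneg)
    then show "ennreal (f x) = liminf (\<lambda>n. ennreal (s n x))"
      by (metis lim_imp_Liminf trivial_limit_sequentially)
  qed
  also have "\<dots> \<le> liminf (\<lambda>n. \<integral>\<^sup>+ x. ennreal (s n x) \<partial>M)" by (rule nn_integral_liminf) simp
  also have "\<dots> \<le> liminf (\<lambda>n::nat. C)" by (rule Liminf_mono) (simp add: s_le)
  also have "\<dots> = C" by (simp add: Liminf_const)
  finally show ?thesis .
qed

lemma (in prob_space) integral_le_of_truncation:
  fixes f g :: "'a \<Rightarrow> real"
  assumes f_measurable[measurable]: "f \<in> borel_measurable M"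
    and minorant: "integrable M g" "\<And>x. x \<in> space M \<Longrightarrow> g x \<le> f x"
    and r_nonneg: "r \<ge> 0" "0 \<le> b + r"
    and truncation_le: "(\<integral>\<^sup>+ x. ennreal (max (f x) (- r) + r) \<partial>M) \<le> ennreal (b + r)"
  shows "integrable M f" and "(\<integral>x. f x \<partial>M) \<le> b"
proof -
  let ?t = "\<lambda>x. max (f x) (- r) + r"
  have t_int: "integrable M ?t"
    by (rule integrableI_nonneg) (use truncation_le in \<open>auto intro: le_less_trans\<close>)
  show f_int: "integrable M f"
  proof (rule Bochner_Integration.integrable_bound[OF _ f_measurable])
    show "integrable M (\<lambda>x. \<bar>?t x\<bar> + \<bar>g x\<bar>)" using t_int minorant(1) by simp
    show "AE x in M. norm (f x) \<le> norm (\<bar>?t x\<bar> + \<bar>g x\<bar>)"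
      using minorant(2) r_nonneg(1) by (intro AE_I2) (fastforce simp: max_def)
  qed
  have "ennreal (\<integral>x. ?t x \<partial>M) \<le> ennreal (b + r)"
    using nn_integral_eq_integral[OF t_int] truncation_le by simp
  then have "(\<integral>x. ?t x \<partial>M) \<le> b + r" using r_nonneg(2) by (simp add: ennreal_le_iff)
  moreover have "(\<integral>x. f x + r \<partial>M) \<le> (\<integral>x. ?t x \<partial>M)"
    by (rule integral_mono) (use f_int t_int in auto)
  ultimately show "(\<integral>x. f x \<partial>M) \<le> b" using f_int by (simp add: prob_space)
qed

section \<open>Kantorovich duality\<close>

locale multimarginal =
  fixes N :: nat and X :: "nat \<Rightarrow> 'a metric" and \<mu> :: "nat \<Rightarrow> 'a measure"
    and c :: "(nat \<Rightarrow> 'a) \<Rightarrow> real" and a :: "nat \<Rightarrow> 'a \<Rightarrow> real"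
  assumes N_pos: "N \<ge> 1"
    and polish: "\<And>k. k \<in> {1..N} \<Longrightarrow> mcomplete_of (X k) \<and> separable_space (mtopology_of (X k))"
    and borel: "\<And>k. k \<in> {1..N} \<Longrightarrow> prob_space (\<mu> k) \<and> sets (\<mu> k) = sets (borel_of (mtopology_of (X k)))"
    and lsc: "lsc_top (product_topology (\<lambda>k. mtopology_of (X k)) {1..N}) c"
    and a_int: "\<And>k. k \<in> {1..N} \<Longrightarrow> integrable (\<mu> k) (a k)"
    and c_lb: "\<And>x. x \<in> PiE {1..N} (\<lambda>k. mspace (X k)) \<Longrightarrow> (\<Sum>k\<in>{1..N}. a k (x k)) \<le> c x"
begin

abbreviation prodtop :: "(nat \<Rightarrow> 'a) topology" where
  "prodtop \<equiv> product_topology (\<lambda>k. mtopology_of (X k)) {1..N}"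

abbreviation \<Omega> :: "(nat \<Rightarrow> 'a) set" where
  "\<Omega> \<equiv> PiE {1..N} (\<lambda>k. mspace (X k))"

lemma one_mem: "1 \<in> {1..N}"
  using N_pos by simp

lemma topspace_prodtop: "topspace prodtop = \<Omega>"
  by simp

lemma prob_space_\<mu>: "k \<in> {1..N} \<Longrightarrow> prob_space (\<mu> k)"
  using borel by simp

lemma sets_\<mu>: "k \<in> {1..N} \<Longrightarrow> sets (\<mu> k) = sets (borel_of (mtopology_of (X k)))"
  using borel by simp

lemma space_\<mu>: "k \<in> {1..N} \<Longrightarrow> space (\<mu> k) = mspace (X k)"
  using sets_eq_imp_space_eq[OF sets_\<mu>] by simp

lemma polish_X: "k \<in> {1..N} \<Longrightarrow> polish_topology (mtopology_of (X k))"
  using polish polish_topology_mtopology_of by blast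

lemma polish_prodtop: "polish_topology prodtop"
  by (rule polish_topology_product_topology[OF finite_atLeastAtMost polish_X])

lemma space_PiM_\<mu>: "space (PiM {1..N} \<mu>) = \<Omega>"
  unfolding space_PiM by (rule PiE_cong) (rule space_\<mu>)

lemma sets_PiM_\<mu>: "sets (PiM {1..N} \<mu>) = sets (borel_of prodtop)"
proof -
  have "sets (PiM {1..N} \<mu>) = sets (PiM {1..N} (\<lambda>k. borel_of (mtopology_of (X k))))"
    by (rule sets_PiM_cong[OF refl sets_\<mu>])
  also have "\<dots> = sets (borel_of prodtop)"
    using polish_X by (intro sets_PiM_borel_of) (auto simp: polish_topology_def)
  finally show ?thesis .
qed

lemma open_superlevel_c: "openin prodtop {x \<in> \<Omega>. t < c x}"
  using lsc by (simp add: lsc_top_def)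

lemma c_measurable: "c \<in> borel_measurable (PiM {1..N} \<mu>)"
  unfolding borel_measurable_iff_greater space_PiM_\<mu> sets_PiM_\<mu>
  using borel_of_open[OF open_superlevel_c] by blast

subsection \<open>Separable functions\<close>

definition integrable_family :: "(nat \<Rightarrow> 'a \<Rightarrow> real) \<Rightarrow> bool" where
  "integrable_family \<psi> \<longleftrightarrow> (\<forall>k\<in>{1..N}. integrable (\<mu> k) (\<psi> k))"

definition dual_value :: "(nat \<Rightarrow> 'a \<Rightarrow> real) \<Rightarrow> real" where
  "dual_value \<psi> = (\<Sum>k\<in>{1..N}. \<integral>y. \<psi> k y \<partial>\<mu> k)"

definition separable_sum :: "(nat \<Rightarrow> 'a \<Rightarrow> real) \<Rightarrow> (nat \<Rightarrow> 'a) \<Rightarrow> real" where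
  "separable_sum \<psi> x = (\<Sum>k\<in>{1..N}. \<psi> k (x k))"

lemma dual_adm_iff:
  "dual_adm N X \<mu> c \<psi> \<longleftrightarrow> integrable_family \<psi> \<and> (\<forall>x\<in>\<Omega>. separable_sum \<psi> x \<le> c x)"
  by (simp add: dual_adm_def integrable_family_def separable_sum_def)

lemma integrable_family_add:
  "integrable_family \<psi> \<Longrightarrow> integrable_family \<eta> \<Longrightarrow> integrable_family (\<lambda>k y. \<psi> k y + \<eta> k y)"
  by (simp add: integrable_family_def)

lemma dual_value_add:
  "integrable_family \<psi> \<Longrightarrow> integrable_family \<eta> \<Longrightarrow>
    dual_value (\<lambda>k y. \<psi> k y + \<eta> k y) = dual_value \<psi> + dual_value \<eta>"
  by (simp add: integrable_family_def dual_value_def sum.distrib)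

lemma separable_sum_add:
  "separable_sum (\<lambda>k y. \<psi> k y + \<eta> k y) x = separable_sum \<psi> x + separable_sum \<eta> x"
  by (simp add: separable_sum_def sum.distrib)

lemma integrable_family_scale: "integrable_family \<psi> \<Longrightarrow> integrable_family (\<lambda>k y. r * \<psi> k y)"
  by (simp add: integrable_family_def)

lemma dual_value_scale: "dual_value (\<lambda>k y. r * \<psi> k y) = r * dual_value \<psi>"
  by (simp add: dual_value_def sum_distrib_left)

lemma separable_sum_scale: "separable_sum (\<lambda>k y. r * \<psi> k y) x = r * separable_sum \<psi> x"
  by (simp add: separable_sum_def sum_distrib_left)

definition single_family :: "nat \<Rightarrow> ('a \<Rightarrow> real) \<Rightarrow> nat \<Rightarrow> 'a \<Rightarrow> real" where
  "single_family k f = (\<lambda>i. if i = k then f else (\<lambda>y. 0))"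

lemma integrable_family_single: "integrable (\<mu> k) f \<Longrightarrow> integrable_family (single_family k f)"
  by (simp add: integrable_family_def single_family_def)

lemma dual_value_single: "k \<in> {1..N} \<Longrightarrow> dual_value (single_family k f) = (\<integral>y. f y \<partial>\<mu> k)"
  unfolding dual_value_def single_family_def
  by (subst sum.remove[of _ k]) auto

lemma separable_sum_single: "k \<in> {1..N} \<Longrightarrow> separable_sum (single_family k f) x = f (x k)"
  unfolding separable_sum_def single_family_def
  by (subst sum.remove[of _ k]) auto

definition const_family :: "real \<Rightarrow> nat \<Rightarrow> 'a \<Rightarrow> real" where
  "const_family b = single_family 1 (\<lambda>y. b)"

lemma integrable_family_const: "integrable_family (const_family b)"
  unfolding const_family_def using prob_space_\<mu>[OF one_mem]
  by (intro integrable_family_single finite_measure.integrable_const prob_space.finite_measure)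

lemma dual_value_const: "dual_value (const_family b) = b"
  unfolding const_family_def dual_value_single[OF one_mem]
  using prob_space.prob_space[OF prob_space_\<mu>[OF one_mem]] by simp

lemma separable_sum_const: "separable_sum (const_family b) x = b"
  unfolding const_family_def by (rule separable_sum_single[OF one_mem])

subsection \<open>Plans\<close>

context
  fixes P assumes P: "P \<in> plans N \<mu>"
begin

lemma plan_sets: "sets P = sets (PiM {1..N} \<mu>)"
  using P by (simp add: plans_def)

lemma plan_space: "space P = \<Omega>"
  using sets_eq_imp_space_eq[OF plan_sets] space_PiM_\<mu> by simp

lemma plan_proj: "k \<in> {1..N} \<Longrightarrow> (\<lambda>x. x k) \<in> P \<rightarrow>\<^sub>M \<mu> k"
  using measurable_component_singleton[of k "{1..N}" \<mu>] measurable_cong_sets[OF plan_sets refl]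
  by blast

lemma plan_marginal: "k \<in> {1..N} \<Longrightarrow> distr P (\<mu> k) (\<lambda>x. x k) = \<mu> k"
  using P by (simp add: plans_def)

lemma plan_prob_space: "prob_space P"
  using prob_space_distrD[OF plan_proj[OF one_mem]] prob_space_\<mu>[OF one_mem]
    plan_marginal[OF one_mem] by simp

lemma plan_integrable_proj:
  fixes f :: "'a \<Rightarrow> real"
  assumes k: "k \<in> {1..N}" and f_integrable: "integrable (\<mu> k) f"
  shows "integrable P (\<lambda>x. f (x k))" and "(\<integral>x. f (x k) \<partial>P) = (\<integral>y. f y \<partial>\<mu> k)"
proof -
  have "integrable (distr P (\<mu> k) (\<lambda>x. x k)) f"
    using f_integrable by (simp add: plan_marginal[OF k])
  then show "integrable P (\<lambda>x. f (x k))" by (rule integrable_distr[OF plan_proj[OF k]])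
  show "(\<integral>x. f (x k) \<partial>P) = (\<integral>y. f y \<partial>\<mu> k)"
    using integral_distr[OF plan_proj[OF k], of f] f_integrable plan_marginal[OF k] by auto
qed

lemma
  assumes "integrable_family \<psi>"
  shows plan_integrable_separable_sum: "integrable P (separable_sum \<psi>)"
    and plan_integral_separable_sum: "(\<integral>x. separable_sum \<psi> x \<partial>P) = dual_value \<psi>"
  using assms plan_integrable_proj
  by (auto simp: integrable_family_def separable_sum_def[abs_def] dual_value_def integral_sum)

end

subsection \<open>Superhedging\<close>

definition superhedges :: "real \<Rightarrow> (nat \<Rightarrow> 'a \<Rightarrow> real) \<Rightarrow> ((nat \<Rightarrow> 'a) discrete \<Rightarrow>\<^sub>C real) \<Rightarrow> bool" where
  "superhedges t \<psi> f \<longleftrightarrow> t \<ge> 0 \<and> integrable_family \<psi> \<and>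
     (\<forall>x\<in>\<Omega>. f (discrete x) \<le> t * c x + separable_sum \<psi> x)"

lemma superhedges_add:
  assumes "superhedges s \<psi> f" "superhedges t \<eta> g"
  shows "superhedges (s + t) (\<lambda>k y. \<psi> k y + \<eta> k y) (f + g)"
  using assms
  by (fastforce simp: superhedges_def integrable_family_add separable_sum_add plus_bcontfun.rep_eq
    algebra_simps)

lemma superhedges_scale:
  assumes "superhedges t \<psi> f" "r > 0"
  shows "superhedges (r * t) (\<lambda>k y. r * \<psi> k y) (r *\<^sub>R f)"
proof -
  have "r * f (discrete x) \<le> r * t * c x + r * separable_sum \<psi> x" if "x \<in> \<Omega>" for x
    using mult_left_mono[of "f (discrete x)" "t * c x + separable_sum \<psi> x" r] assms that
    by (simp add: superhedges_def algebra_simps)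
  then show ?thesis
    using assms by (simp add: superhedges_def integrable_family_scale separable_sum_scale
      scaleR_bcontfun.rep_eq)
qed

lemma superhedges_norm: "superhedges 0 (const_family (norm f)) f"
proof -
  have "apply_bcontfun f z \<le> norm f" for z using norm_bounded[of f z] by simp
  then show ?thesis by (simp add: superhedges_def integrable_family_const separable_sum_const)
qed

lemma superhedges_zero_imp_nonneg:
  assumes plan: "P \<in> plans N \<mu>" and dual_bound: "\<And>\<psi>. dual_adm N X \<mu> c \<psi> \<Longrightarrow> dual_value \<psi> \<le> D"
    and hedge: "superhedges t \<psi> 0"
  shows "0 \<le> t * D + dual_value \<psi>"
proof -
  have t_nonneg: "t \<ge> 0" and \<psi>_integrable: "integrable_family \<psi>"
    and superhedged: "\<And>x. x \<in> \<Omega> \<Longrightarrow> 0 \<le> t * c x + separable_sum \<psi> x"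
    using hedge by (auto simp: superhedges_def)
  show ?thesis
  proof (cases "t = 0")
    case True
    have "0 \<le> (\<integral>x. separable_sum \<psi> x \<partial>P)"
      by (rule integral_nonneg_AE) (use superhedged True plan_space[OF plan]
        in \<open>auto intro!: AE_I2\<close>)
    then show ?thesis using True plan_integral_separable_sum[OF plan \<psi>_integrable] by simp
  next
    case False
    have "separable_sum (\<lambda>k y. (- 1 / t) * \<psi> k y) x \<le> c x" if "x \<in> \<Omega>" for x
      unfolding separable_sum_scale using superhedged[OF that] t_nonneg False
      by (simp add: field_simps)
    then have "dual_adm N X \<mu> c (\<lambda>k y. (- 1 / t) * \<psi> k y)"
      unfolding dual_adm_iff using integrable_family_scale[OF \<psi>_integrable] by blast
    from dual_bound[OF this] show ?thesis
      unfolding dual_value_scale using t_nonneg False by (simp add: field_simps)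
  qed
qed

text \<open>The prices at which \<open>f\<close> can be superhedged when \<open>c\<close> itself can be bought for \<open>D\<close>.\<close>

definition superhedging_prices :: "real \<Rightarrow> ((nat \<Rightarrow> 'a) discrete \<Rightarrow>\<^sub>C real) \<Rightarrow> real set" where
  "superhedging_prices D f = {t * D + dual_value \<psi> | t \<psi>. superhedges t \<psi> f}"

lemma superhedging_pricesI: "superhedges t \<psi> f \<Longrightarrow> t * D + dual_value \<psi> \<in> superhedging_prices D f"
  by (auto simp: superhedging_prices_def)

lemma superhedging_pricesE:
  assumes "u \<in> superhedging_prices D f"
  obtains t \<psi> where "superhedges t \<psi> f" "integrable_family \<psi>" "u = t * D + dual_value \<psi>"
  using assms by (auto simp: superhedging_prices_def superhedges_def)

lemma bdd_below_superhedging_prices: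
  assumes plan: "P \<in> plans N \<mu>" and dual_bound: "\<And>\<psi>. dual_adm N X \<mu> c \<psi> \<Longrightarrow> dual_value \<psi> \<le> D"
  shows "bdd_below (superhedging_prices D f)"
proof (rule bdd_belowI)
  fix u assume "u \<in> superhedging_prices D f"
  then obtain t \<psi> where hedge: "superhedges t \<psi> f" and "integrable_family \<psi>"
    and "u = t * D + dual_value \<psi>"
    by (rule superhedging_pricesE)
  moreover have "superhedges t (\<lambda>k y. \<psi> k y + const_family (norm f) k y) 0"
    using superhedges_add[OF hedge superhedges_norm[of "- f"]] by simp
  from superhedges_zero_imp_nonneg[OF plan dual_bound this]
  have "0 \<le> t * D + dual_value (\<lambda>k y. \<psi> k y + const_family (norm f) k y)" .
  ultimately show "- norm f \<le> u"
    by (simp add: dual_value_add integrable_family_const dual_value_const)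
qed

lemma sublinear_superhedging_price:
  assumes plan: "P \<in> plans N \<mu>" and dual_bound: "\<And>\<psi>. dual_adm N X \<mu> c \<psi> \<Longrightarrow> dual_value \<psi> \<le> D"
  shows "sublinear (\<lambda>f. Inf (superhedging_prices D f))"
proof (rule sublinear_Inf)
  show "superhedging_prices D f \<noteq> {}" for f using superhedging_pricesI[OF superhedges_norm] by blast
  fix f g u v assume "u \<in> superhedging_prices D f" "v \<in> superhedging_prices D g"
  then obtain s \<psi> t \<eta> where \<psi>: "superhedges s \<psi> f" "integrable_family \<psi>" "u = s * D + dual_value \<psi>"
    and \<eta>: "superhedges t \<eta> g" "integrable_family \<eta>" "v = t * D + dual_value \<eta>"
    by (auto elim!: superhedging_pricesE)
  have "(s + t) * D + dual_value (\<lambda>k y. \<psi> k y + \<eta> k y) = u + v"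
    by (simp add: dual_value_add \<psi> \<eta> algebra_simps)
  then show "\<exists>w\<in>superhedging_prices D (f + g). w \<le> u + v"
    using superhedging_pricesI[OF superhedges_add[OF \<psi>(1) \<eta>(1)], of D] by auto
next
  fix f u and r :: real assume "u \<in> superhedging_prices D f" and r: "r > 0"
  then obtain t \<psi> where \<psi>: "superhedges t \<psi> f" "u = t * D + dual_value \<psi>"
    by (auto elim!: superhedging_pricesE)
  have "(r * t) * D + dual_value (\<lambda>k y. r * \<psi> k y) = r * u"
    by (simp add: \<psi> dual_value_scale algebra_simps)
  then show "r * u \<in> superhedging_prices D (r *\<^sub>R f)"
    using superhedging_pricesI[OF superhedges_scale[OF \<psi>(1) r], of D] by simp
qed (rule bdd_below_superhedging_prices[OF plan dual_bound])

lemma linear_le_superhedging_price: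
  assumes plan: "P \<in> plans N \<mu>" and dual_bound: "\<And>\<psi>. dual_adm N X \<mu> c \<psi> \<Longrightarrow> dual_value \<psi> \<le> D"
  obtains L where "linear L" "\<And>t \<psi> f. superhedges t \<psi> f \<Longrightarrow> L f \<le> t * D + dual_value \<psi>"
proof -
  obtain L where linear: "linear L" and L_le: "L \<le> (\<lambda>f. Inf (superhedging_prices D f))"
    using sublinear_superhedging_price[OF plan dual_bound] by (rule sublinear_dominates_linear)
  have "L f \<le> t * D + dual_value \<psi>" if "superhedges t \<psi> f" for t \<psi> f
  proof -
    have "Inf (superhedging_prices D f) \<le> t * D + dual_value \<psi>"
      by (intro cInf_lower superhedging_pricesI that
        bdd_below_superhedging_prices[OF plan dual_bound])
    then show ?thesis using le_funD[OF L_le, of f] by simp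
  qed
  with linear show thesis by (rule that)
qed

end

locale finitely_additive_plan = multimarginal +
  fixes L :: "((nat \<Rightarrow> 'a) discrete \<Rightarrow>\<^sub>C real) \<Rightarrow> real" and D :: real
  assumes linear: "linear L" and L_le: "superhedges t \<psi> f \<Longrightarrow> L f \<le> t * D + dual_value \<psi>"
begin

definition charge :: "(nat \<Rightarrow> 'a) set \<Rightarrow> real" where
  "charge E = L (bounded_indicator E)"

lemma charge_nonneg: "0 \<le> charge E"
proof -
  have "superhedges 0 (const_family 0) (- bounded_indicator E)"
    by (simp add: superhedges_def integrable_family_const separable_sum_const
      uminus_bcontfun.rep_eq)
  from L_le[OF this] show ?thesis
    by (simp add: dual_value_const charge_def linear_neg[OF linear])
qed

sublocale topological_content prodtop "Pow (topspace prodtop)" charge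
proof -
  interpret algebra "topspace prodtop" "Pow (topspace prodtop)" by (rule algebra_Pow)
  show "topological_content prodtop (Pow (topspace prodtop)) charge"
  proof unfold_locales
    show "U \<in> Pow (topspace prodtop)" if "openin prodtop U" for U
      using openin_subset[OF that] by blast
    show "charge (E \<union> F) = charge E + charge F" if "E \<inter> F = {}" for E F
      by (simp add: charge_def bounded_indicator_Un_disjoint[OF that] linear_add[OF linear])
  qed (rule charge_nonneg)
qed

lemma charge_cylinder:
  assumes k: "k \<in> {1..N}" and A_sets: "A \<in> sets (\<mu> k)"
  shows "charge {x \<in> \<Omega>. x k \<in> A} = measure (\<mu> k) A"
proof -
  interpret prob_space "\<mu> k" by (rule prob_space_\<mu>[OF k])
  have "r * charge {x \<in> \<Omega>. x k \<in> A} \<le> r * measure (\<mu> k) A" for r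
  proof -
    let ?\<psi> = "single_family k (\<lambda>y. r * indicator A y)"
    have "integrable (\<mu> k) (\<lambda>y. r * indicator A y)"
      using A_sets by (intro integrable_mult_right integrable_real_indicator)
        (auto simp: less_top[symmetric])
    then have "superhedges 0 ?\<psi> (r *\<^sub>R bounded_indicator {x \<in> \<Omega>. x k \<in> A})"
      by (simp add: superhedges_def integrable_family_single separable_sum_single[OF k]
          scaleR_bcontfun.rep_eq indicator_def)
    from L_le[OF this] show ?thesis
      using sets.sets_into_space[OF A_sets]
      by (simp add: charge_def linear_scale[OF linear] dual_value_single[OF k] Int_absorb2)
  qed
  from this[of 1] this[of "-1"] show ?thesis by simp
qed

lemma charge_tight:
  assumes "e > 0"
  shows "\<exists>K. compactin prodtop K \<and> closedin prodtop K \<and> charge (topspace prodtop - K) \<le> e"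
proof -
  have e_div_pos: "e / N > 0" using assms N_pos by simp
  have "\<forall>k\<in>{1..N}. \<exists>K. compactin (mtopology_of (X k)) K \<and> measure (\<mu> k) (mspace (X k) - K) \<le> e / N"
  proof
    fix k assume k: "k \<in> {1..N}"
    interpret prob_space "\<mu> k" by (rule prob_space_\<mu>[OF k])
    show "\<exists>K. compactin (mtopology_of (X k)) K \<and> measure (\<mu> k) (mspace (X k) - K) \<le> e / N"
      using borel_tight[OF polish_X[OF k] sets_\<mu>[OF k] e_div_pos] by (metis topspace_mtopology_of)
  qed
  from bchoice[OF this] obtain K where
    K: "\<forall>k\<in>{1..N}. compactin (mtopology_of (X k)) (K k) \<and>
      measure (\<mu> k) (mspace (X k) - K k) \<le> e / N" ..
  have meas: "mspace (X k) - K k \<in> sets (\<mu> k)" if k: "k \<in> {1..N}" for k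
  proof -
    have "closedin (mtopology_of (X k)) (K k)"
      using K k compactin_imp_closedin[OF polish_topology_imp_Hausdorff[OF polish_X[OF k]]] by blast
    then have "openin (mtopology_of (X k)) (mspace (X k) - K k)" by (simp add: closedin_def)
    then show ?thesis by (simp add: sets_\<mu>[OF k] borel_of_open)
  qed
  let ?K = "PiE {1..N} K"
  have compact: "compactin prodtop ?K" unfolding compactin_PiE using K by blast
  have "topspace prodtop - ?K \<subseteq> (\<Union>k\<in>{1..N}. {x \<in> \<Omega>. x k \<in> mspace (X k) - K k})"
    unfolding topspace_prodtop by (auto simp: PiE_iff)
  then have "charge (topspace prodtop - ?K) \<le> charge (\<Union>k\<in>{1..N}. {x \<in> \<Omega>. x k \<in> mspace (X k) - K k})"
    by (rule content_mono[rotated 2]) auto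
  also have "\<dots> \<le> (\<Sum>k\<in>{1..N}. charge {x \<in> \<Omega>. x k \<in> mspace (X k) - K k})"
    by (rule content_UN_le) auto
  also have "\<dots> = (\<Sum>k\<in>{1..N}. measure (\<mu> k) (mspace (X k) - K k))"
    by (intro sum.cong refl charge_cylinder meas)
  also have "\<dots> \<le> (\<Sum>k\<in>{1..N}. e / N)" by (rule sum_mono) (use K in auto)
  also have "\<dots> = e" using N_pos by simp
  finally show ?thesis
    using compact compactin_imp_closedin[OF polish_topology_imp_Hausdorff[OF polish_prodtop]]
    by blast
qed

sublocale tight_content prodtop "Pow (topspace prodtop)" charge
  by unfold_locales (rule charge_tight)

abbreviation charge_regular :: "(nat \<Rightarrow> 'a) set set" where
  "charge_regular \<equiv> regular_sets prodtop (Pow (topspace prodtop)) charge"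

lemma cylinder_regular:
  assumes k: "k \<in> {1..N}" and A_sets: "A \<in> sets (\<mu> k)"
  shows "{x \<in> \<Omega>. x k \<in> A} \<in> charge_regular"
proof (rule regular_setsI)
  fix e :: real assume e: "e > 0"
  interpret prob_space "\<mu> k" by (rule prob_space_\<mu>[OF k])
  have "A \<in> regular_sets (mtopology_of (X k)) (sets (\<mu> k)) (measure (\<mu> k))"
    using A_sets regular_sets_borel[OF polish_topology_imp_metrizable[OF polish_X[OF k]]
      sets_\<mu>[OF k]] by simp
  then obtain C U where C: "closedin (mtopology_of (X k)) C" "C \<subseteq> A"
    and U: "openin (mtopology_of (X k)) U" "A \<subseteq> U" and gap_le: "measure (\<mu> k) (U - C) \<le> e"
    using e by (rule regular_setsE)
  have proj: "continuous_map prodtop (mtopology_of (X k)) (\<lambda>x. x k)"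
    by (rule continuous_map_product_projection[OF k])
  have "U - C \<in> sets (\<mu> k)" using U C by (auto simp: sets_\<mu>[OF k] borel_of_open borel_of_closed)
  from charge_cylinder[OF k this] gap_le have "charge {x \<in> \<Omega>. x k \<in> U - C} \<le> e" by simp
  moreover have "{x \<in> \<Omega>. x k \<in> U} - {x \<in> \<Omega>. x k \<in> C} = {x \<in> \<Omega>. x k \<in> U - C}" by auto
  moreover have "closedin prodtop {x \<in> \<Omega>. x k \<in> C}" "openin prodtop {x \<in> \<Omega>. x k \<in> U}"
    using closedin_continuous_map_preimage[OF proj C(1)]
      openin_continuous_map_preimage[OF proj U(1)]
    unfolding topspace_prodtop .
  ultimately show "sandwiched prodtop charge e {x \<in> \<Omega>. x k \<in> A}"
    using C(2) U(2) by (intro sandwichedI[of prodtop "{x \<in> \<Omega>. x k \<in> C}" "{x \<in> \<Omega>. x k \<in> U}"]) auto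
qed auto

lemma box_regular:
  assumes "\<And>k. k \<in> {1..N} \<Longrightarrow> A k \<in> sets (\<mu> k)"
  shows "PiE {1..N} A \<in> charge_regular"
proof -
  interpret R: algebra "topspace prodtop" charge_regular
    by (rule algebra_regular_sets)
  have "A k \<subseteq> mspace (X k)" if "k \<in> {1..N}" for k
    using sets.sets_into_space[OF assms[OF that]] space_\<mu>[OF that] by simp
  then have "PiE {1..N} A \<subseteq> \<Omega>" by (rule PiE_mono)
  then have "x \<in> PiE {1..N} A \<longleftrightarrow> x \<in> (\<Inter>k\<in>{1..N}. {x \<in> \<Omega>. x k \<in> A k})" for x
    using one_mem unfolding PiE_iff subset_iff by blast
  then have "PiE {1..N} A = (\<Inter>k\<in>{1..N}. {x \<in> \<Omega>. x k \<in> A k})" by (rule set_eqI)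
  moreover have "(\<Inter>k\<in>{1..N}. {x \<in> \<Omega>. x k \<in> A k}) \<in> charge_regular"
    using one_mem by (intro R.finite_INT cylinder_regular assms) auto
  ultimately show ?thesis by simp
qed

lemma regular_boxes_base:
  obtains \<B> where "countable_base prodtop \<B>" "\<B> \<subseteq> charge_regular"
proof -
  have "\<forall>k\<in>{1..N}. \<exists>\<B>. countable_base (mtopology_of (X k)) \<B>"
    using polish_X by (simp add: polish_topology_def second_countable_iff_countable_base)
  from bchoice[OF this]
  obtain \<B> where bases: "\<forall>k\<in>{1..N}. countable_base (mtopology_of (X k)) (\<B> k)" ..
  have "countable_base prodtop (PiE {1..N} ` PiE {1..N} \<B>)"
    by (rule countable_base_PiE) (use bases in auto)
  moreover have "PiE {1..N} ` PiE {1..N} \<B> \<subseteq> charge_regular"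
  proof (rule image_subsetI)
    fix V assume V: "V \<in> PiE {1..N} \<B>"
    have "V k \<in> sets (\<mu> k)" if k: "k \<in> {1..N}" for k
      using countable_baseD(2)[OF bspec[OF bases k] PiE_mem[OF V k]]
      by (simp add: sets_\<mu>[OF k] borel_of_open)
    then show "PiE {1..N} V \<in> charge_regular" by (rule box_regular)
  qed
  ultimately show thesis by (rule that)
qed

definition dominated_plan :: "(nat \<Rightarrow> 'a) measure \<Rightarrow> bool" where
  "dominated_plan P \<longleftrightarrow>
     P \<in> plans N \<mu> \<and> (\<forall>W. openin prodtop W \<longrightarrow> emeasure P W \<le> ennreal (charge W))"

lemma dominated_plan_exists: "\<exists>P. dominated_plan P"
proof -
  obtain \<B> where "countable_base prodtop \<B>" "\<B> \<subseteq> charge_regular" by (rule regular_boxes_base)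
  then obtain P where sets_P_borel: "sets P = sets (borel_of prodtop)"
    and P_regular: "\<And>E. E \<in> charge_regular \<Longrightarrow>
      E \<in> sets (borel_of prodtop) \<Longrightarrow> emeasure P E = ennreal (charge E)"
    and P_open: "\<And>W. openin prodtop W \<Longrightarrow> emeasure P W \<le> ennreal (charge W)"
    by (rule borel_measure_extension) blast
  have sets_P: "sets P = sets (PiM {1..N} \<mu>)" unfolding sets_P_borel sets_PiM_\<mu> ..
  have space_P: "space P = \<Omega>" using sets_eq_imp_space_eq[OF sets_P] unfolding space_PiM_\<mu> .
  have "distr P (\<mu> k) (\<lambda>x. x k) = \<mu> k" if k: "k \<in> {1..N}" for k
  proof (rule measure_eqI)
    interpret prob_space "\<mu> k" by (rule prob_space_\<mu>[OF k])
    fix A assume "A \<in> sets (distr P (\<mu> k) (\<lambda>x. x k))"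
    then have A_sets: "A \<in> sets (\<mu> k)" by simp
    have proj: "(\<lambda>x. x k) \<in> P \<rightarrow>\<^sub>M \<mu> k"
      using measurable_component_singleton[OF k, of \<mu>] measurable_cong_sets[OF sets_P refl] by blast
    have cylinder: "(\<lambda>x. x k) -` A \<inter> space P = {x \<in> \<Omega>. x k \<in> A}" by (auto simp: space_P)
    have "emeasure (distr P (\<mu> k) (\<lambda>x. x k)) A = emeasure P {x \<in> \<Omega>. x k \<in> A}"
      by (simp only: emeasure_distr[OF proj A_sets] cylinder)
    also have "\<dots> = ennreal (charge {x \<in> \<Omega>. x k \<in> A})"
      using measurable_sets[OF proj A_sets] unfolding cylinder sets_P_borel
      by (rule P_regular[OF cylinder_regular[OF k A_sets]])
    also have "\<dots> = emeasure (\<mu> k) A"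
      unfolding charge_cylinder[OF k A_sets] by (rule emeasure_eq_measure[symmetric])
    finally show "emeasure (distr P (\<mu> k) (\<lambda>x. x k)) A = emeasure (\<mu> k) A" .
  qed simp
  then have "P \<in> plans N \<mu>" using sets_P by (simp add: plans_def)
  then show ?thesis using P_open by (auto simp only: dominated_plan_def)
qed

lemma layer_sum_charge_le:
  assumes \<psi>_integrable: "integrable_family \<psi>" and h_pos: "h > 0"
    and f_bounds: "\<And>x. x \<in> \<Omega> \<Longrightarrow> 0 \<le> f x" "\<And>x. x \<in> \<Omega> \<Longrightarrow> f x \<le> c x + separable_sum \<psi> x"
  shows "(\<Sum>i\<in>{1..K}. h * charge {x \<in> \<Omega>. real i * h < f x}) \<le> D + dual_value \<psi>"
proof -
  let ?s = "\<Sum>i\<in>{1..K}. h *\<^sub>R bounded_indicator {x \<in> \<Omega>. real i * h < f x}"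
  have "?s (discrete x) \<le> 1 * c x + separable_sum \<psi> x" if x: "x \<in> \<Omega>" for x
  proof -
    have "?s (discrete x) = layer_sum h K (f x)"
      unfolding layer_sum_def apply_bcontfun_sum
      using x by (intro sum.cong) (simp_all add: scaleR_bcontfun.rep_eq indicator_def)
    also have "\<dots> \<le> f x" by (rule layer_sum_bounds(1)[OF h_pos f_bounds(1)[OF x]])
    also have "\<dots> \<le> 1 * c x + separable_sum \<psi> x" using f_bounds(2)[OF x] by simp
    finally show ?thesis .
  qed
  then have "superhedges 1 \<psi> ?s" using \<psi>_integrable unfolding superhedges_def by simp
  from L_le[OF this] show ?thesis
    by (simp add: charge_def linear_sum[OF linear] linear_scale[OF linear])
qed

lemma nn_integral_le_dual_value:
  assumes dominated: "dominated_plan P"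
    and \<psi>_integrable: "integrable_family \<psi>" and f_measurable: "f \<in> borel_measurable P"
    and f_open: "\<And>r. r \<ge> 0 \<Longrightarrow> openin prodtop {x \<in> \<Omega>. r < f x}"
    and f_bounds: "\<And>x. x \<in> \<Omega> \<Longrightarrow> 0 \<le> f x" "\<And>x. x \<in> \<Omega> \<Longrightarrow> f x \<le> c x + separable_sum \<psi> x"
  shows "(\<integral>\<^sup>+ x. ennreal (f x) \<partial>P) \<le> ennreal (D + dual_value \<psi>)"
proof (rule nn_integral_le_of_layer_sums_le[OF f_measurable])
  have plan: "P \<in> plans N \<mu>" and P_open: "\<And>W. openin prodtop W \<Longrightarrow> emeasure P W \<le> ennreal (charge W)"
    using dominated by (simp_all only: dominated_plan_def)
  show "0 \<le> f x" if "x \<in> space P" for x using that f_bounds(1) plan_space[OF plan] by simp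
  fix h :: real and K assume h_pos: "h > 0"
  have "(\<Sum>i\<in>{1..K}. ennreal h * emeasure P {x \<in> space P. real i * h < f x}) \<le>
      (\<Sum>i\<in>{1..K}. ennreal h * ennreal (charge {x \<in> \<Omega>. real i * h < f x}))"
    unfolding plan_space[OF plan] using h_pos by (intro sum_mono mult_left_mono P_open f_open) auto
  also have "\<dots> = ennreal (\<Sum>i\<in>{1..K}. h * charge {x \<in> \<Omega>. real i * h < f x})"
    using h_pos by (subst sum_ennreal[symmetric]) (auto simp: charge_nonneg ennreal_mult)
  also have "\<dots> \<le> ennreal (D + dual_value \<psi>)"
    by (intro ennreal_leI layer_sum_charge_le \<psi>_integrable h_pos f_bounds)
  finally show "(\<Sum>i\<in>{1..K}. ennreal h * emeasure P {x \<in> space P. real i * h < f x}) \<le>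
      ennreal (D + dual_value \<psi>)" .
qed

text \<open>As \<open>a k\<close> is merely integrable, subtracting \<open>separable_sum a\<close> from \<open>c\<close> would destroy lower
  semicontinuity; truncating \<open>c\<close> at a constant does not.\<close>

definition tail :: "nat \<Rightarrow> nat \<Rightarrow> 'a \<Rightarrow> real" where
  "tail m k y = max 0 (- real m - a k y)"

lemma integrable_family_tail: "integrable_family (tail m)"
  unfolding integrable_family_def
proof
  fix k assume k: "k \<in> {1..N}"
  interpret prob_space "\<mu> k" by (rule prob_space_\<mu>[OF k])
  show "integrable (\<mu> k) (tail m k)" unfolding tail_def[abs_def] using a_int[OF k] by simp
qed

lemma truncated_cost_le_tail:
  assumes "x \<in> \<Omega>"
  shows "max (c x) (- (N * m)) \<le> c x + separable_sum (tail m) x"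
proof -
  have "- (real N * m) = (\<Sum>k\<in>{1..N}. - real m)" by simp
  also have "\<dots> \<le> (\<Sum>k\<in>{1..N}. a k (x k) + tail m k (x k))" by (rule sum_mono) (simp add: tail_def)
  also have "\<dots> \<le> c x + separable_sum (tail m) x"
    using c_lb[OF assms] by (simp add: sum.distrib separable_sum_def)
  finally have "- (real N * m) \<le> c x + separable_sum (tail m) x" .
  moreover have "0 \<le> separable_sum (tail m) x"
    unfolding separable_sum_def tail_def by (intro sum_nonneg) simp
  ultimately show ?thesis by simp
qed

lemma dual_value_tail_tendsto: "(\<lambda>m. dual_value (tail m)) \<longlonglongrightarrow> 0"
proof -
  have "(\<lambda>m. \<integral>y. tail m k y \<partial>\<mu> k) \<longlonglongrightarrow> (\<integral>y. 0 \<partial>\<mu> k)" if k: "k \<in> {1..N}" for k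
  proof (rule integral_dominated_convergence[where w="\<lambda>y. \<bar>a k y\<bar>"])
    show "integrable (\<mu> k) (\<lambda>y. \<bar>a k y\<bar>)" using a_int[OF k] by simp
    show "tail m k \<in> borel_measurable (\<mu> k)" for m
      using integrable_family_tail[of m] k by (auto simp: integrable_family_def)
    show "AE y in \<mu> k. (\<lambda>m. tail m k y) \<longlonglongrightarrow> 0"
    proof (rule AE_I2)
      fix y
      obtain m0 :: nat where "- a k y \<le> real m0" using real_arch_simple by blast
      then show "(\<lambda>m. tail m k y) \<longlonglongrightarrow> 0"
        by (intro tendsto_eventually eventually_sequentiallyI[of m0]) (simp add: tail_def)
    qed
    show "AE y in \<mu> k. norm (tail m k y) \<le> \<bar>a k y\<bar>" for m by (rule AE_I2) (auto simp: tail_def)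
  qed simp
  then have "(\<lambda>m. dual_value (tail m)) \<longlonglongrightarrow> (\<Sum>k\<in>{1..N}. \<integral>y. 0 \<partial>\<mu> k)"
    unfolding dual_value_def by (intro tendsto_sum)
  then show ?thesis by simp
qed

lemma cost_integral_le_tail:
  assumes dominated: "dominated_plan P"
  shows "integrable P c" and "(\<integral>x. c x \<partial>P) \<le> D + dual_value (tail m)"
proof -
  have plan: "P \<in> plans N \<mu>" using dominated by (simp only: dominated_plan_def)
  interpret P: prob_space P by (rule plan_prob_space[OF plan])
  have c_measurable_P[measurable]: "c \<in> borel_measurable P"
    using c_measurable measurable_cong_sets[OF plan_sets[OF plan] refl] by blast
  let ?r = "real N * real m"
  let ?f = "\<lambda>x. max (c x) (- ?r) + ?r"
  let ?\<psi> = "\<lambda>k y. tail m k y + const_family ?r k y"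
  have \<psi>_integrable: "integrable_family ?\<psi>"
    by (intro integrable_family_add integrable_family_tail integrable_family_const)
  have f_le: "?f x \<le> c x + separable_sum ?\<psi> x" if "x \<in> \<Omega>" for x
    using truncated_cost_le_tail[OF that, of m] by (simp add: separable_sum_add separable_sum_const)
  have f_open: "openin prodtop {x \<in> \<Omega>. r < ?f x}" if "r \<ge> 0" for r
  proof -
    have "r < ?f x \<longleftrightarrow> r - ?r < c x" for x using that by (auto simp: max_def)
    then show ?thesis by (simp only: open_superlevel_c)
  qed
  have value_\<psi>: "D + dual_value ?\<psi> = D + dual_value (tail m) + ?r"
    by (simp add: dual_value_add integrable_family_tail integrable_family_const dual_value_const)
  have "(\<integral>\<^sup>+ x. ennreal (?f x) \<partial>P) \<le> ennreal (D + dual_value ?\<psi>)"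
    by (rule nn_integral_le_dual_value[OF dominated \<psi>_integrable _ f_open _ f_le]) simp_all
  moreover have "0 \<le> D + dual_value ?\<psi>"
    using layer_sum_charge_le[OF \<psi>_integrable zero_less_one _ f_le, of 0] by simp
  moreover have "integrable P (separable_sum a)"
    using a_int by (intro plan_integrable_separable_sum[OF plan]) (simp add: integrable_family_def)
  moreover have "separable_sum a x \<le> c x" if "x \<in> space P" for x
    using that c_lb by (simp add: plan_space[OF plan] separable_sum_def)
  ultimately show "integrable P c" "(\<integral>x. c x \<partial>P) \<le> D + dual_value (tail m)"
    unfolding value_\<psi>
    using P.integral_le_of_truncation[OF c_measurable_P, of "separable_sum a" ?r
      "D + dual_value (tail m)"] by simp_all
qed

lemma plan_cost_le: "\<exists>P\<in>plans N \<mu>. integrable P c \<and> (\<integral>x. c x \<partial>P) \<le> D"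
proof -
  obtain P where P: "dominated_plan P" using dominated_plan_exists ..
  have "(\<lambda>m. D + dual_value (tail m)) \<longlonglongrightarrow> D + 0" by (intro tendsto_intros dual_value_tail_tendsto)
  then have "(\<integral>x. c x \<partial>P) \<le> D + 0"
    by (rule LIMSEQ_le_const) (use cost_integral_le_tail(2)[OF P] in blast)
  then show ?thesis using P cost_integral_le_tail(1)[OF P] by (auto simp: dominated_plan_def)
qed

end

theorem (in multimarginal) kantorovich_duality:
  assumes plan: "P \<in> plans N \<mu>" and dual_bound: "\<And>\<psi>. dual_adm N X \<mu> c \<psi> \<Longrightarrow> dual_value \<psi> \<le> D"
  shows "\<exists>P\<in>plans N \<mu>. integrable P c \<and> (\<integral>x. c x \<partial>P) \<le> D"
proof (rule linear_le_superhedging_price[OF plan dual_bound])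
  fix L assume "linear L" "\<And>t \<psi> f. superhedges t \<psi> f \<Longrightarrow> L f \<le> t * D + dual_value \<psi>"
  then interpret finitely_additive_plan N X \<mu> c a L D
    by (intro finitely_additive_plan.intro multimarginal_axioms finitely_additive_plan_axioms.intro)
  show ?thesis by (rule plan_cost_le)
qed

section \<open>Graphs and disintegrations\<close>

lemma graph_measurable:
  assumes separating: "second_countable T" "Hausdorff_space T"
    and sets_N: "sets N = sets (borel_of T)" and f_measurable[measurable]: "f \<in> M \<rightarrow>\<^sub>M N"
  shows "{z \<in> space (M \<Otimes>\<^sub>M N). snd z = f (fst z)} \<in> sets (M \<Otimes>\<^sub>M N)"
proof -
  have space_N: "space N = topspace T" using sets_eq_imp_space_eq[OF sets_N] by simp
  have "(\<lambda>y. (y, y)) ` topspace T \<in> sets (borel_of (prod_topology T T))"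
    using separating(2) Hausdorff_space_closedin_diagonal borel_of_closed by blast
  then have diagonal: "(\<lambda>y. (y, y)) ` topspace T \<in> sets (N \<Otimes>\<^sub>M N)"
    using sets_pair_measure_borel_of[OF separating(1) separating(1)]
      sets_pair_measure_cong[OF sets_N sets_N] by simp
  have pair: "(\<lambda>z. (snd z, f (fst z))) \<in> M \<Otimes>\<^sub>M N \<rightarrow>\<^sub>M N \<Otimes>\<^sub>M N" by measurable
  have "{z \<in> space (M \<Otimes>\<^sub>M N). snd z = f (fst z)} =
      (\<lambda>z. (snd z, f (fst z))) -` ((\<lambda>y. (y, y)) ` topspace T) \<inter> space (M \<Otimes>\<^sub>M N)"
    by (auto simp: space_pair_measure space_N)
  then show ?thesis using measurable_sets[OF pair diagonal] by simp
qed

lemma AE_eq_of_distr_eq_graph: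
  assumes separating: "second_countable T" "Hausdorff_space T"
    and sets_N: "sets N = sets (borel_of T)" and f_measurable[measurable]: "f \<in> M \<rightarrow>\<^sub>M N"
    and g_measurable: "g \<in> P \<rightarrow>\<^sub>M M \<Otimes>\<^sub>M N"
    and distr_eq: "distr P (M \<Otimes>\<^sub>M N) g = distr M (M \<Otimes>\<^sub>M N) (\<lambda>x. (x, f x))"
  shows "AE x in P. snd (g x) = f (fst (g x))"
proof -
  note graph = graph_measurable[OF separating sets_N f_measurable]
  have "(\<lambda>x. (x, f x)) \<in> M \<rightarrow>\<^sub>M M \<Otimes>\<^sub>M N" by measurable
  from AE_distr_iff[OF this graph]
  have "AE z in distr P (M \<Otimes>\<^sub>M N) g. snd z = f (fst z)" unfolding distr_eq by simp
  then show ?thesis using AE_distr_iff[OF g_measurable graph] by simp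
qed

lemma emeasure_bind_distr_Pair:
  assumes nonempty: "space M \<noteq> {}" and kernel: "\<kappa> \<in> M \<rightarrow>\<^sub>M subprob_algebra L"
    and A_sets: "A \<in> sets (M \<Otimes>\<^sub>M L)"
  shows "emeasure (M \<bind> (\<lambda>x. distr (\<kappa> x) (M \<Otimes>\<^sub>M L) (Pair x))) A =
    (\<integral>\<^sup>+ x. emeasure (\<kappa> x) (Pair x -` A) \<partial>M)"
proof -
  have "(\<lambda>x. distr (\<kappa> x) (M \<Otimes>\<^sub>M L) (Pair x)) \<in> M \<rightarrow>\<^sub>M subprob_algebra (M \<Otimes>\<^sub>M L)"
    by (rule measurable_distr2[OF _ kernel]) simp
  from emeasure_bind[OF nonempty this A_sets]
  have "emeasure (M \<bind> (\<lambda>x. distr (\<kappa> x) (M \<Otimes>\<^sub>M L) (Pair x))) A =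
      (\<integral>\<^sup>+ x. emeasure (distr (\<kappa> x) (M \<Otimes>\<^sub>M L) (Pair x)) A \<partial>M)" .
  also have "\<dots> = (\<integral>\<^sup>+ x. emeasure (\<kappa> x) (Pair x -` A) \<partial>M)"
  proof (rule nn_integral_cong)
    fix x assume x: "x \<in> space M"
    have sets: "sets (\<kappa> x) = sets L"
      using measurable_space[OF kernel x] by (simp add: space_subprob_algebra)
    have "Pair x \<in> \<kappa> x \<rightarrow>\<^sub>M M \<Otimes>\<^sub>M L"
      unfolding measurable_cong_sets[OF sets refl] by (rule measurable_Pair1'[OF x])
    from emeasure_distr[OF this A_sets]
    show "emeasure (distr (\<kappa> x) (M \<Otimes>\<^sub>M L) (Pair x)) A = emeasure (\<kappa> x) (Pair x -` A)"
      using sets.sets_into_space[OF A_sets] sets_eq_imp_space_eq[OF sets]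
      by (simp add: Int_absorb2 space_pair_measure subset_iff)
  qed
  finally show ?thesis .
qed

lemma emeasure_disintegration:
  assumes nonempty: "space M \<noteq> {}" and finite_Q: "finite_measure Q"
    and sets_Q: "sets Q = sets (M \<Otimes>\<^sub>M L)"
    and kernel: "\<kappa> \<in> M \<rightarrow>\<^sub>M subprob_algebra L"
    and rect: "\<And>E F. E \<in> sets M \<Longrightarrow> F \<in> sets L \<Longrightarrow> emeasure Q (E \<times> F) = (\<integral>\<^sup>+ x\<in>E. emeasure (\<kappa> x) F \<partial>M)"
    and A_sets: "A \<in> sets (M \<Otimes>\<^sub>M L)"
  shows "emeasure Q A = (\<integral>\<^sup>+ x. emeasure (\<kappa> x) (Pair x -` A) \<partial>M)"
proof -
  interpret Q: finite_measure Q by fact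
  let ?B = "M \<bind> (\<lambda>x. distr (\<kappa> x) (M \<Otimes>\<^sub>M L) (Pair x))"
  let ?E = "{E \<times> F |E F. E \<in> sets M \<and> F \<in> sets L}"
  have sets_B: "sets ?B = sets (M \<Otimes>\<^sub>M L)" by (rule sets_bind[OF _ nonempty]) simp
  have "Q = ?B"
  proof (rule measure_eqI_generator_eq[where E="?E" and \<Omega>="space M \<times> space L" and
    A="\<lambda>_::nat. space M \<times> space L"])
    show "Int_stable ?E" by (rule Int_stable_pair_measure_generator)
    show "?E \<subseteq> Pow (space M \<times> space L)" by (auto dest: sets.sets_into_space)
    show "sets Q = sigma_sets (space M \<times> space L) ?E" unfolding sets_Q by (rule sets_pair_measure)
    show "sets ?B = sigma_sets (space M \<times> space L) ?E" unfolding sets_B by (rule sets_pair_measure)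
    show "range (\<lambda>_::nat. space M \<times> space L) \<subseteq> ?E" by auto
    fix R assume "R \<in> ?E"
    then obtain E F where R: "R = E \<times> F" and E: "E \<in> sets M" and F: "F \<in> sets L" by blast
    have "emeasure Q R = (\<integral>\<^sup>+ x\<in>E. emeasure (\<kappa> x) F \<partial>M)" unfolding R by (rule rect[OF E F])
    also have "\<dots> = (\<integral>\<^sup>+ x. emeasure (\<kappa> x) (Pair x -` R) \<partial>M)"
      by (rule nn_integral_cong) (auto simp: R indicator_def)
    also have "\<dots> = emeasure ?B R"
      by (rule emeasure_bind_distr_Pair[OF nonempty kernel, symmetric]) (use R E F in auto)
    finally show "emeasure Q R = emeasure ?B R" .
  qed (auto simp: Q.emeasure_finite)
  then show ?thesis using emeasure_bind_distr_Pair[OF nonempty kernel A_sets] by simp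
qed

lemma fun_upd_restrict_measurable:
  assumes i: "i \<in> I" and sets_K: "sets K = sets (M i)"
    and t: "\<And>j. j \<in> I - {i} \<Longrightarrow> t j \<in> space (M j)"
  shows "(\<lambda>y. (restrict t I)(i := y)) \<in> K \<rightarrow>\<^sub>M PiM I M"
proof (rule measurable_PiM_single')
  show "(\<lambda>y. ((restrict t I)(i := y)) j) \<in> K \<rightarrow>\<^sub>M M j" if "j \<in> I" for j
    using t[of j] that measurable_ident_sets[OF sets_K] by (cases "j = i") auto
  show "(\<lambda>y. (restrict t I)(i := y)) \<in> space K \<rightarrow> (\<Pi>\<^sub>E j\<in>I. space (M j))"
    using i t sets_eq_imp_space_eq[OF sets_K] by (auto simp: PiE_iff extensional_def)
qed

lemma PiM_return_fun_upd:
  fixes \<nu> :: "'i \<Rightarrow> 'x measure" and \<kappa> :: "'x measure"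
  assumes I: "finite I" and i: "i \<in> I" and \<kappa>: "prob_space \<kappa>" "sets \<kappa> = sets (\<nu> i)"
    and t: "\<And>j. j \<in> I - {i} \<Longrightarrow> t j \<in> space (\<nu> j)"
  shows "PiM I ((\<lambda>j. return (\<nu> j) (t j))(i := \<kappa>)) = distr \<kappa> (PiM I \<nu>) (\<lambda>y. (restrict t I)(i := y))"
proof -
  interpret \<kappa>: prob_space \<kappa> by fact
  define M where "M j = (if j \<in> I then ((\<lambda>j. return (\<nu> j) (t j))(i := \<kappa>)) j else \<kappa>)" for j
  let ?h = "\<lambda>y. (restrict t I)(i := y)"
  have "prob_space (M j)" for j unfolding M_def using \<kappa>(1) t by (auto intro: prob_space_return)
  then interpret product_sigma_finite M
    by unfold_locales
      (meson prob_space_imp_sigma_finite sigma_finite_measure.sigma_finite_countable)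
  have sets_M: "sets (M j) = sets (\<nu> j)" if "j \<in> I" for j using that \<kappa>(2) by (simp add: M_def)
  have h_measurable: "?h \<in> \<kappa> \<rightarrow>\<^sub>M PiM I \<nu>"
    by (rule fun_upd_restrict_measurable[where M=\<nu>, OF i \<kappa>(2)]) (rule t)
  have "distr \<kappa> (PiM I \<nu>) ?h = PiM I M"
  proof (rule PiM_eqI[OF I])
    show "sets (distr \<kappa> (PiM I \<nu>) ?h) = sets (PiM I M)"
      using sets_PiM_cong[OF refl sets_M, of I] by simp
    fix A assume "\<And>j. j \<in> I \<Longrightarrow> A j \<in> sets (M j)"
    then have A: "A j \<in> sets (\<nu> j)" if "j \<in> I" for j using that sets_M by blast
    have "?h y \<in> PiE I A \<longleftrightarrow> (\<forall>j\<in>I - {i}. t j \<in> A j) \<and> y \<in> A i" for y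
      using i by (auto simp: PiE_iff extensional_def)
    moreover have "A i \<subseteq> space \<kappa>"
      using sets.sets_into_space[OF A[OF i]] sets_eq_imp_space_eq[OF \<kappa>(2)] by simp
    ultimately have "?h -` PiE I A \<inter> space \<kappa> = (if \<forall>j\<in>I - {i}. t j \<in> A j then A i else {})"
      by auto
    then have "emeasure (distr \<kappa> (PiM I \<nu>) ?h) (PiE I A) =
        emeasure \<kappa> (if \<forall>j\<in>I - {i}. t j \<in> A j then A i else {})"
      by (simp add: emeasure_distr[OF h_measurable sets_PiM_I_finite[OF I A]])
    also have "\<dots> = emeasure \<kappa> (A i) * (\<Prod>j\<in>I - {i}. indicator (A j) (t j))"
      using I by (auto simp: indicator_def prod_zero_iff)
    also have "\<dots> = emeasure (M i) (A i) * (\<Prod>j\<in>I - {i}. emeasure (M j) (A j))"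
      using i A by (auto simp: M_def intro!: arg_cong2[where f="(*)"] prod.cong)
    also have "\<dots> = (\<Prod>j\<in>I. emeasure (M j) (A j))" by (rule prod.remove[OF I i, symmetric])
    finally show "emeasure (distr \<kappa> (PiM I \<nu>) ?h) (PiE I A) = (\<Prod>j\<in>I. emeasure (M j) (A j))" .
  qed
  also have "PiM I M = PiM I ((\<lambda>j. return (\<nu> j) (t j))(i := \<kappa>))"
    by (rule PiM_cong) (simp_all add: M_def)
  finally show ?thesis ..
qed

lemma borel_measurable_completion_AE:
  fixes f g :: "'x \<Rightarrow> 'b::topological_space"
  assumes g_measurable: "g \<in> borel_measurable M" and AE_eq: "AE x in M. f x = g x"
  shows "f \<in> borel_measurable (completion M)"
proof (rule measurableI)
  obtain Z where Z: "{x \<in> space M. f x \<noteq> g x} \<subseteq> Z" "Z \<in> null_sets M"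
    using AE_eq by (auto elim!: AE_E)
  fix A :: "'b set" assume A: "A \<in> sets borel"
  show "f -` A \<inter> space (completion M) \<in> sets (completion M)"
  proof (rule sets_completionI)
    show "f -` A \<inter> space (completion M) = (g -` A \<inter> space M - Z) \<union> (f -` A \<inter> space M \<inter> Z)"
      using Z(1) by auto
    show "g -` A \<inter> space M - Z \<in> sets M" using measurable_sets[OF g_measurable A] Z(2) by auto
  qed (use Z in auto)
qed simp

section \<open>Marginals of optimal plans\<close>

locale dual_optimum = multimarginal +
  fixes \<phi> :: "nat \<Rightarrow> 'a \<Rightarrow> real"
  assumes dual: "dual_sol N X \<mu> c \<phi>"
begin

lemma integrable_family_\<phi>: "integrable_family \<phi>"
  using dual by (simp add: dual_sol_def dual_adm_iff)

lemma separable_sum_\<phi>_le: "x \<in> \<Omega> \<Longrightarrow> separable_sum \<phi> x \<le> c x"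
  using dual by (simp add: dual_sol_def dual_adm_iff)

lemma dual_value_le: "dual_adm N X \<mu> c \<psi> \<Longrightarrow> dual_value \<psi> \<le> dual_value \<phi>"
  using dual by (simp add: dual_sol_def dual_value_def)

lemma opt_MK_imp_plan: "opt_MK N \<mu> c P \<Longrightarrow> P \<in> plans N \<mu>"
  by (simp add: opt_MK_def)

lemma complementary_slackness:
  assumes opt: "opt_MK N \<mu> c P"
  shows "AE x in P. c x = separable_sum \<phi> x"
proof -
  have plan: "P \<in> plans N \<mu>" and c_int: "integrable P c" using opt by (auto simp: opt_MK_def)
  note \<phi>_int = plan_integrable_separable_sum[OF plan integrable_family_\<phi>]
  obtain P' where P': "P' \<in> plans N \<mu>" "integrable P' c" "(\<integral>x. c x \<partial>P') \<le> dual_value \<phi>"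
    using kantorovich_duality[OF plan dual_value_le] by blast
  have "(\<integral>x. c x \<partial>P) \<le> (\<integral>x. c x \<partial>P')" using opt P' by (simp add: opt_MK_def)
  also have "\<dots> \<le> (\<integral>x. separable_sum \<phi> x \<partial>P)"
    using P'(3) by (simp add: plan_integral_separable_sum[OF plan integrable_family_\<phi>])
  finally have "(\<integral>x. c x - separable_sum \<phi> x \<partial>P) \<le> 0"
    by (simp add: Bochner_Integration.integral_diff[OF c_int \<phi>_int])
  moreover have nonneg: "AE x in P. 0 \<le> c x - separable_sum \<phi> x"
    by (rule AE_I2) (use separable_sum_\<phi>_le plan_space[OF plan] in simp)
  ultimately have "(\<integral>x. c x - separable_sum \<phi> x \<partial>P) = 0"
    using integral_nonneg_AE[OF nonneg] by linarith
  then have "AE x in P. c x - separable_sum \<phi> x = 0"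
    using integral_nonneg_eq_0_iff_AE[OF Bochner_Integration.integrable_diff[OF c_int \<phi>_int] nonneg]
    by simp
  then show ?thesis by eventually_elim simp
qed

context
  fixes j assumes j: "j \<in> {2..N}"
begin

lemma j_mem: "j \<in> {1..N}" and j_neq_1: "j \<noteq> 1"
  using j by auto

definition completed_costs :: "'a \<Rightarrow> 'a \<Rightarrow> real set" where
  "completed_costs x1 xj = {c (y(1 := x1, j := xj)) - (\<Sum>k\<in>{1..N} - {1, j}. \<phi> k (y k)) |y.
     y \<in> (\<Pi>\<^sub>E k\<in>{1..N} - {1, j}. mspace (X k))}"

lemma cost_1j_eq_Inf: "cost_1j N X c \<phi> j x1 xj = Inf (completed_costs x1 xj)"
  by (simp add: cost_1j_def completed_costs_def)

lemma separable_sum_split_1j: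
  "separable_sum \<phi> x = \<phi> 1 (x 1) + \<phi> j (x j) + (\<Sum>k\<in>{1..N} - {1, j}. \<phi> k (x k))"
proof -
  have "separable_sum \<phi> x = (\<Sum>k\<in>{1..N} - {1, j}. \<phi> k (x k)) + (\<Sum>k\<in>{1, j}. \<phi> k (x k))"
    unfolding separable_sum_def by (rule sum.subset_diff) (use j_mem one_mem in auto)
  then show ?thesis using j_neq_1 by simp
qed

lemma completed_costs_ge:
  assumes "x1 \<in> mspace (X 1)" "xj \<in> mspace (X j)" "v \<in> completed_costs x1 xj"
  shows "\<phi> 1 x1 + \<phi> j xj \<le> v"
proof -
  obtain y where y: "y \<in> (\<Pi>\<^sub>E k\<in>{1..N} - {1, j}. mspace (X k))"
    and v: "v = c (y(1 := x1, j := xj)) - (\<Sum>k\<in>{1..N} - {1, j}. \<phi> k (y k))"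
    using assms(3) by (auto simp: completed_costs_def)
  let ?z = "y(1 := x1, j := xj)"
  have "?z \<in> \<Omega>" using y assms(1,2) j_mem one_mem unfolding PiE_iff extensional_def by auto
  then have "separable_sum \<phi> ?z \<le> c ?z" by (rule separable_sum_\<phi>_le)
  moreover have "(\<Sum>k\<in>{1..N} - {1, j}. \<phi> k (?z k)) = (\<Sum>k\<in>{1..N} - {1, j}. \<phi> k (y k))"
    by (rule sum.cong) auto
  ultimately show ?thesis using j_neq_1 by (simp add: v separable_sum_split_1j)
qed

lemma cost_1j_ge:
  assumes mspaces: "x1 \<in> mspace (X 1)" "xj \<in> mspace (X j)"
  shows "\<phi> 1 x1 + \<phi> j xj \<le> cost_1j N X c \<phi> j x1 xj"
  unfolding cost_1j_eq_Inf
proof (rule cInf_greatest)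
  have "mspace (X k) \<noteq> {}" if "k \<in> {1..N}" for k
    using prob_space.not_empty[OF prob_space_\<mu>[OF that]] space_\<mu>[OF that] by simp
  then have "PiE ({1..N} - {1, j}) (\<lambda>k. mspace (X k)) \<noteq> {}" unfolding PiE_eq_empty_iff by blast
  then show "completed_costs x1 xj \<noteq> {}" unfolding completed_costs_def by blast
qed (rule completed_costs_ge[OF mspaces])

lemma cost_1j_eq_on_contact_set:
  assumes x_mem: "x \<in> \<Omega>" and contact: "c x = separable_sum \<phi> x"
  shows "cost_1j N X c \<phi> j (x 1) (x j) = \<phi> 1 (x 1) + \<phi> j (x j)"
proof (rule antisym)
  have x1j: "x 1 \<in> mspace (X 1)" "x j \<in> mspace (X j)"
    using PiE_mem[OF x_mem] one_mem j_mem by blast+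
  let ?y = "restrict x ({1..N} - {1, j})"
  have "?y(1 := x 1, j := x j) = x"
    using x_mem one_mem j_mem unfolding PiE_iff extensional_def by (auto simp: fun_eq_iff)
  moreover have "(\<Sum>k\<in>{1..N} - {1, j}. \<phi> k (?y k)) = (\<Sum>k\<in>{1..N} - {1, j}. \<phi> k (x k))"
    by (rule sum.cong) auto
  ultimately have "\<phi> 1 (x 1) + \<phi> j (x j) =
      c (?y(1 := x 1, j := x j)) - (\<Sum>k\<in>{1..N} - {1, j}. \<phi> k (?y k))"
    using contact by (simp add: separable_sum_split_1j)
  moreover have "?y \<in> (\<Pi>\<^sub>E k\<in>{1..N} - {1, j}. mspace (X k))" using x_mem by (auto simp: PiE_iff)
  ultimately have "\<phi> 1 (x 1) + \<phi> j (x j) \<in> completed_costs (x 1) (x j)"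
    unfolding completed_costs_def by blast
  then show "cost_1j N X c \<phi> j (x 1) (x j) \<le> \<phi> 1 (x 1) + \<phi> j (x j)"
    unfolding cost_1j_eq_Inf using completed_costs_ge[OF x1j] by (intro cInf_lower bdd_belowI)
  show "\<phi> 1 (x 1) + \<phi> j (x j) \<le> cost_1j N X c \<phi> j (x 1) (x j)" by (rule cost_1j_ge[OF x1j])
qed

abbreviation marginal_1j :: "(nat \<Rightarrow> 'a) measure \<Rightarrow> ('a \<times> 'a) measure" where
  "marginal_1j P \<equiv> distr P (\<mu> 1 \<Otimes>\<^sub>M \<mu> j) (\<lambda>x. (x 1, x j))"

lemma proj_1j_measurable: "P \<in> plans N \<mu> \<Longrightarrow> (\<lambda>x. (x 1, x j)) \<in> P \<rightarrow>\<^sub>M \<mu> 1 \<Otimes>\<^sub>M \<mu> j"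
  by (intro measurable_Pair plan_proj one_mem j_mem)

lemma marginal_1j_plan:
  assumes plan: "P \<in> plans N \<mu>"
  shows "marginal_1j P \<in> plans2 (\<mu> 1) (\<mu> j)"
  using distr_distr[OF measurable_fst proj_1j_measurable[OF plan]] plan_marginal[OF plan one_mem]
    distr_distr[OF measurable_snd proj_1j_measurable[OF plan]] plan_marginal[OF plan j_mem]
  by (simp add: plans2_def comp_def)

lemma plans2_space: "\<tau> \<in> plans2 (\<mu> 1) (\<mu> j) \<Longrightarrow> space \<tau> = mspace (X 1) \<times> mspace (X j)"
  using sets_eq_imp_space_eq[of \<tau> "\<mu> 1 \<Otimes>\<^sub>M \<mu> j"]
  by (simp only: plans2_def mem_Collect_eq space_pair_measure space_\<mu>[OF one_mem] space_\<mu>[OF j_mem])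

lemma
  assumes plan: "\<tau> \<in> plans2 (\<mu> 1) (\<mu> j)"
  shows plans2_potential_measurable: "(\<lambda>z. \<phi> 1 (fst z) + \<phi> j (snd z)) \<in> borel_measurable \<tau>"
    and plans2_potential_integrable: "integrable (completion \<tau>) (\<lambda>z. \<phi> 1 (fst z) + \<phi> j (snd z))"
    and plans2_potential_integral:
      "(\<integral>z. \<phi> 1 (fst z) + \<phi> j (snd z) \<partial>completion \<tau>) = (\<integral>y. \<phi> 1 y \<partial>\<mu> 1) + (\<integral>y. \<phi> j y \<partial>\<mu> j)"
proof -
  have sets: "sets \<tau> = sets (\<mu> 1 \<Otimes>\<^sub>M \<mu> j)" and fst: "distr \<tau> (\<mu> 1) fst = \<mu> 1"
    and snd: "distr \<tau> (\<mu> j) snd = \<mu> j"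
    using plan by (auto simp: plans2_def)
  have fst_meas: "fst \<in> \<tau> \<rightarrow>\<^sub>M \<mu> 1" and snd_meas: "snd \<in> \<tau> \<rightarrow>\<^sub>M \<mu> j"
    using measurable_cong_sets[OF sets refl] by auto
  have \<phi>: "integrable (\<mu> 1) (\<phi> 1)" "integrable (\<mu> j) (\<phi> j)"
    using integrable_family_\<phi> one_mem j_mem unfolding integrable_family_def by blast+
  have int: "integrable \<tau> (\<lambda>z. \<phi> 1 (fst z))" "integrable \<tau> (\<lambda>z. \<phi> j (snd z))"
    using integrable_distr[OF fst_meas, of "\<phi> 1"] integrable_distr[OF snd_meas, of "\<phi> j"] \<phi> fst snd
    by auto
  then show meas: "(\<lambda>z. \<phi> 1 (fst z) + \<phi> j (snd z)) \<in> borel_measurable \<tau>" by simp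
  show "integrable (completion \<tau>) (\<lambda>z. \<phi> 1 (fst z) + \<phi> j (snd z))"
    using int meas by (simp add: integrable_completion)
  have "(\<integral>z. \<phi> 1 (fst z) \<partial>\<tau>) = (\<integral>y. \<phi> 1 y \<partial>\<mu> 1)" "(\<integral>z. \<phi> j (snd z) \<partial>\<tau>) = (\<integral>y. \<phi> j y \<partial>\<mu> j)"
    using integral_distr[OF fst_meas, of "\<phi> 1"] integral_distr[OF snd_meas, of "\<phi> j"] \<phi> fst snd
    by auto
  then show "(\<integral>z. \<phi> 1 (fst z) + \<phi> j (snd z) \<partial>completion \<tau>) = (\<integral>y. \<phi> 1 y \<partial>\<mu> 1) + (\<integral>y. \<phi> j y \<partial>\<mu> j)"
    unfolding integral_completion[OF meas] using int by simp
qed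

lemma AE_marginal_cost_1j:
  assumes opt: "opt_MK N \<mu> c P"
  shows "AE z in marginal_1j P. case_prod (cost_1j N X c \<phi> j) z = \<phi> 1 (fst z) + \<phi> j (snd z)"
proof -
  let ?T = "prod_topology (mtopology_of (X 1)) (mtopology_of (X j))"
  have plan: "P \<in> plans N \<mu>" by (rule opt_MK_imp_plan[OF opt])
  interpret P: prob_space P by (rule plan_prob_space[OF plan])
  have "AE z in marginal_1j P. \<exists>x\<in>topspace prodtop. c x = separable_sum \<phi> x \<and> (x 1, x j) = z"
  proof (rule P.AE_distr_continuous_image[OF polish_prodtop _ complementary_slackness[OF opt]])
    show "sets P = sets (borel_of prodtop)" using plan_sets[OF plan] by (simp only: sets_PiM_\<mu>)
    show "continuous_map prodtop ?T (\<lambda>x. (x 1, x j))"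
      by (intro continuous_map_pairedI continuous_map_product_projection one_mem j_mem)
    show "Hausdorff_space ?T"
      unfolding Hausdorff_space_prod_topology
      using polish_topology_imp_Hausdorff polish_X one_mem j_mem by blast
    show "sets (\<mu> 1 \<Otimes>\<^sub>M \<mu> j) = sets (borel_of ?T)"
      unfolding sets_pair_measure_cong[OF sets_\<mu>[OF one_mem] sets_\<mu>[OF j_mem]]
      using polish_X[OF one_mem] polish_X[OF j_mem] unfolding polish_topology_def
      by (intro sets_pair_measure_borel_of) simp_all
  qed
  then show ?thesis
  proof eventually_elim
    case (elim z)
    then obtain x where x: "x \<in> \<Omega>" "c x = separable_sum \<phi> x" and z: "z = (x 1, x j)" by auto
    show ?case using cost_1j_eq_on_contact_set[OF x] by (simp add: z)
  qed
qed

lemma marginal_1j_optimal: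
  assumes opt: "opt_MK N \<mu> c P"
  shows "opt2 (\<mu> 1) (\<mu> j) (case_prod (cost_1j N X c \<phi> j)) (marginal_1j P)"
proof -
  let ?f = "case_prod (cost_1j N X c \<phi> j)" and ?g = "\<lambda>z. \<phi> 1 (fst z) + \<phi> j (snd z)"
  have marginal: "marginal_1j P \<in> plans2 (\<mu> 1) (\<mu> j)"
    by (rule marginal_1j_plan[OF opt_MK_imp_plan[OF opt]])
  note AE_eq = AE_marginal_cost_1j[OF opt]
  have f_measurable: "?f \<in> borel_measurable (completion (marginal_1j P))"
    by (rule borel_measurable_completion_AE[OF plans2_potential_measurable[OF marginal] AE_eq])
  have g_measurable: "?g \<in> borel_measurable (completion (marginal_1j P))"
    by (rule measurable_completion[OF plans2_potential_measurable[OF marginal]])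
  have f_int: "integrable (completion (marginal_1j P)) ?f"
    using integrable_cong_AE[OF f_measurable g_measurable AE_completion[OF AE_eq]]
      plans2_potential_integrable[OF marginal] by simp
  have "(\<integral>z. ?f z \<partial>completion (marginal_1j P)) \<le> (\<integral>z. ?f z \<partial>completion \<tau>)"
    if \<tau>: "\<tau> \<in> plans2 (\<mu> 1) (\<mu> j)" "integrable (completion \<tau>) ?f" for \<tau>
  proof -
    have "(\<integral>z. ?f z \<partial>completion (marginal_1j P)) = (\<integral>z. ?g z \<partial>completion (marginal_1j P))"
      by (rule integral_cong_AE[OF f_measurable g_measurable AE_completion[OF AE_eq]])
    also have "\<dots> = (\<integral>z. ?g z \<partial>completion \<tau>)"
      by (simp only: plans2_potential_integral[OF marginal] plans2_potential_integral[OF \<tau>(1)])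
    also have "\<dots> \<le> (\<integral>z. ?f z \<partial>completion \<tau>)"
    proof (rule integral_mono[OF plans2_potential_integrable[OF \<tau>(1)] \<tau>(2)])
      show "?g z \<le> ?f z" if "z \<in> space (completion \<tau>)" for z
        using that plans2_space[OF \<tau>(1)] cost_1j_ge by (auto simp: split_beta)
    qed
    finally show ?thesis .
  qed
  then show ?thesis using marginal f_int by (simp add: opt2_def)
qed

lemma AE_eq_transport_map:
  assumes opt: "opt_MK N \<mu> c P" and f_measurable: "f \<in> \<mu> 1 \<rightarrow>\<^sub>M \<mu> j"
    and unique: "\<And>\<tau>. opt2 (\<mu> 1) (\<mu> j) (case_prod (cost_1j N X c \<phi> j)) \<tau> \<Longrightarrow>
      \<tau> = distr (\<mu> 1) (\<mu> 1 \<Otimes>\<^sub>M \<mu> j) (\<lambda>x. (x, f x))"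
  shows "AE x in P. x j = f (x 1)"
proof -
  have plan: "P \<in> plans N \<mu>" by (rule opt_MK_imp_plan[OF opt])
  have separating: "second_countable (mtopology_of (X j))" "Hausdorff_space (mtopology_of (X j))"
    using polish_X[OF j_mem] polish_topology_imp_Hausdorff by (auto simp: polish_topology_def)
  from AE_eq_of_distr_eq_graph[OF separating sets_\<mu>[OF j_mem]
    f_measurable proj_1j_measurable[OF plan] unique[OF marginal_1j_optimal[OF opt]]]
  show ?thesis by simp
qed

end

end

section \<open>Plans carried by graphs\<close>

locale transport_maps = dual_optimum +
  fixes j0 :: nat and T :: "nat \<Rightarrow> 'a \<Rightarrow> 'a"
  assumes j0: "j0 \<in> {2..N}"
    and maps: "\<And>j. j \<in> {2..N} - {j0} \<Longrightarrow> T j \<in> \<mu> 1 \<rightarrow>\<^sub>M \<mu> j \<and>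
        (\<forall>\<tau>. opt2 (\<mu> 1) (\<mu> j) (case_prod (cost_1j N X c \<phi> j)) \<tau> \<longleftrightarrow>
              \<tau> = distr (\<mu> 1) (\<mu> 1 \<Otimes>\<^sub>M \<mu> j) (\<lambda>x. (x, T j x)))"
begin

definition assemble :: "'a \<times> 'a \<Rightarrow> nat \<Rightarrow> 'a" where
  "assemble z = (\<lambda>j\<in>{1..N}. if j = 1 then fst z else if j = j0 then snd z else T j (fst z))"

lemma assemble_measurable: "assemble \<in> \<mu> 1 \<Otimes>\<^sub>M \<mu> j0 \<rightarrow>\<^sub>M PiM {1..N} \<mu>"
  unfolding assemble_def[abs_def]
proof (rule measurable_restrict)
  fix j assume "j \<in> {1..N}"
  then consider "j = 1" | "j = j0" "j \<noteq> 1" | "j \<in> {2..N} - {j0}" "j \<noteq> 1" by fastforce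
  then show "(\<lambda>z. if j = 1 then fst z else if j = j0 then snd z else T j (fst z))
      \<in> \<mu> 1 \<Otimes>\<^sub>M \<mu> j0 \<rightarrow>\<^sub>M \<mu> j"
  proof cases
    case 3
    then have "T j \<in> \<mu> 1 \<rightarrow>\<^sub>M \<mu> j" using maps by blast
    then show ?thesis using 3 by simp
  qed simp_all
qed

lemma restrict_assemble:
  "restrict (assemble (x, y)) {2..N} = (restrict (\<lambda>j. T j x) {2..N})(j0 := y)"
  using j0 by (auto simp: assemble_def fun_eq_iff)

lemma AE_assemble:
  assumes opt: "opt_MK N \<mu> c P"
  shows "AE x in P. assemble (x 1, x j0) = x"
proof -
  have plan: "P \<in> plans N \<mu>" by (rule opt_MK_imp_plan[OF opt])
  have "AE x in P. \<forall>j\<in>{2..N} - {j0}. x j = T j (x 1)"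
  proof (rule AE_finite_allI)
    fix j assume j: "j \<in> {2..N} - {j0}"
    show "AE x in P. x j = T j (x 1)"
      by (rule AE_eq_transport_map[OF _ opt]) (use j maps[OF j] in blast)+
  qed simp
  then show ?thesis
    using AE_space
  proof eventually_elim
    case (elim x)
    then have x_mem: "x \<in> \<Omega>" by (simp only: plan_space[OF plan])
    have "assemble (x 1, x j0) j = x j" for j
    proof -
      consider "j \<notin> {1..N}" | "j = 1" | "j = j0" | "j \<in> {2..N} - {j0}" "j \<noteq> 1" by fastforce
      then show ?thesis
        using elim(1) j0 by cases (auto simp: assemble_def PiE_arb[OF x_mem])
    qed
    then show ?case by (rule ext)
  qed
qed

lemma optimal_plan_eq_distr_assemble:
  assumes opt: "opt_MK N \<mu> c P"
  shows "P = distr (marginal_1j j0 P) (PiM {1..N} \<mu>) assemble"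
proof -
  have plan: "P \<in> plans N \<mu>" by (rule opt_MK_imp_plan[OF opt])
  note proj = proj_1j_measurable[OF j0 plan]
  have "distr (marginal_1j j0 P) (PiM {1..N} \<mu>) assemble =
      distr P (PiM {1..N} \<mu>) (assemble \<circ> (\<lambda>x. (x 1, x j0)))"
    by (rule distr_distr[OF assemble_measurable proj])
  also have "\<dots> = distr P (PiM {1..N} \<mu>) (\<lambda>x. x)"
    using AE_assemble[OF opt] measurable_comp[OF proj assemble_measurable]
      measurable_ident_sets[OF plan_sets[OF plan]]
    by (intro distr_cong_AE) (auto simp: comp_def)
  also have "\<dots> = P" by (rule distr_id2[OF plan_sets[OF plan, symmetric]])
  finally show ?thesis ..
qed

theorem optimal_plan_unique:
  assumes "\<exists>!\<tau>. opt2 (\<mu> 1) (\<mu> j0) (case_prod (cost_1j N X c \<phi> j0)) \<tau>"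
    and opt: "opt_MK N \<mu> c P" "opt_MK N \<mu> c P'"
  shows "P = P'"
proof -
  have "marginal_1j j0 P = marginal_1j j0 P'"
    using assms(1) marginal_1j_optimal[OF j0 opt(1)] marginal_1j_optimal[OF j0 opt(2)] by blast
  then show ?thesis
    using optimal_plan_eq_distr_assemble[OF opt(1)] optimal_plan_eq_distr_assemble[OF opt(2)]
    by simp
qed

lemma emeasure_PiM_assemble:
  assumes x: "x \<in> space (\<mu> 1)" and \<kappa>_prob: "prob_space \<kappa>" "sets \<kappa> = sets (\<mu> j0)"
    and F_sets: "F \<in> sets (PiM {2..N} \<mu>)"
  shows "emeasure (PiM {2..N} (\<lambda>j. if j = j0 then \<kappa> else return (\<mu> j) (T j x))) F =
    emeasure \<kappa> {y \<in> space \<kappa>. restrict (assemble (x, y)) {2..N} \<in> F}"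
proof -
  let ?h = "\<lambda>y. restrict (assemble (x, y)) {2..N}"
  have "T j x \<in> space (\<mu> j)" if "j \<in> {2..N} - {j0}" for j
    using maps[OF that] measurable_space[OF _ x] by blast
  from PiM_return_fun_upd[where \<nu>=\<mu> and t="\<lambda>j. T j x", OF finite_atLeastAtMost j0 \<kappa>_prob this]
  have PiM_eq: "PiM {2..N} (\<lambda>j. if j = j0 then \<kappa> else return (\<mu> j) (T j x)) =
      distr \<kappa> (PiM {2..N} \<mu>) ?h"
    by (simp only: fun_upd_def restrict_assemble)
  have "Pair x \<in> \<kappa> \<rightarrow>\<^sub>M \<mu> 1 \<Otimes>\<^sub>M \<mu> j0"
    unfolding measurable_cong_sets[OF \<kappa>_prob(2) refl] by (rule measurable_Pair1'[OF x])
  from measurable_comp[OF measurable_comp[OF this assemble_measurable]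
    measurable_restrict_subset[of "{2..N}" "{1..N}" \<mu>]]
  have "?h \<in> \<kappa> \<rightarrow>\<^sub>M PiM {2..N} \<mu>" by (simp add: comp_def)
  from emeasure_distr[OF this F_sets] show ?thesis
    unfolding PiM_eq by (simp add: vimage_def Int_def conj_commute)
qed

lemma emeasure_marginal_1j0:
  assumes plan: "P \<in> plans N \<mu>" and kernel: "\<kappa> \<in> \<mu> 1 \<rightarrow>\<^sub>M prob_algebra (\<mu> j0)"
    and disintegration: "\<And>E F. E \<in> sets (\<mu> 1) \<Longrightarrow> F \<in> sets (\<mu> j0) \<Longrightarrow>
       emeasure P {x \<in> space P. x 1 \<in> E \<and> x j0 \<in> F} = (\<integral>\<^sup>+ x1\<in>E. emeasure (\<kappa> x1) F \<partial>\<mu> 1)"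
    and A_sets: "A \<in> sets (\<mu> 1 \<Otimes>\<^sub>M \<mu> j0)"
  shows "emeasure (marginal_1j j0 P) A = (\<integral>\<^sup>+ x. emeasure (\<kappa> x) (Pair x -` A) \<partial>\<mu> 1)"
proof (rule emeasure_disintegration[OF _ _ _ measurable_prob_algebraD[OF kernel] _ A_sets])
  interpret P: prob_space P by (rule plan_prob_space[OF plan])
  note proj = proj_1j_measurable[OF j0 plan]
  show "space (\<mu> 1) \<noteq> {}" by (rule prob_space.not_empty[OF prob_space_\<mu>[OF one_mem]])
  show "finite_measure (marginal_1j j0 P)" by (rule P.finite_measure_distr[OF proj])
  fix E F assume E: "E \<in> sets (\<mu> 1)" and F: "F \<in> sets (\<mu> j0)"
  have "emeasure (marginal_1j j0 P) (E \<times> F) = emeasure P ((\<lambda>x. (x 1, x j0)) -` (E \<times> F) \<inter> space P)"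
    by (rule emeasure_distr[OF proj]) (use E F in auto)
  also have "(\<lambda>x. (x 1, x j0)) -` (E \<times> F) \<inter> space P = {x \<in> space P. x 1 \<in> E \<and> x j0 \<in> F}" by auto
  finally show "emeasure (marginal_1j j0 P) (E \<times> F) = (\<integral>\<^sup>+ x\<in>E. emeasure (\<kappa> x) F \<partial>\<mu> 1)"
    by (simp only: disintegration[OF E F])
qed simp

lemma emeasure_optimal_plan:
  assumes opt: "opt_MK N \<mu> c P" and E_sets: "E \<in> sets (\<mu> 1)" and F_sets: "F \<in> sets (PiM {2..N} \<mu>)"
  defines "A \<equiv> {z \<in> space (\<mu> 1 \<Otimes>\<^sub>M \<mu> j0). fst z \<in> E \<and> restrict (assemble z) {2..N} \<in> F}"
  shows "A \<in> sets (\<mu> 1 \<Otimes>\<^sub>M \<mu> j0)"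
    and "emeasure P {x \<in> space P. x 1 \<in> E \<and> restrict x {2..N} \<in> F} = emeasure (marginal_1j j0 P) A"
proof -
  have plan: "P \<in> plans N \<mu>" by (rule opt_MK_imp_plan[OF opt])
  let ?M = "\<mu> 1 \<Otimes>\<^sub>M \<mu> j0" and ?R = "PiM {1..N} \<mu>"
  let ?B = "{x \<in> space ?R. x 1 \<in> E \<and> restrict x {2..N} \<in> F}"
  have "(\<lambda>x. restrict x {2..N}) \<in> ?R \<rightarrow>\<^sub>M PiM {2..N} \<mu>" by (rule measurable_restrict_subset) auto
  from measurable_sets[OF this F_sets]
    measurable_sets[OF measurable_component_singleton[OF one_mem, of \<mu>] E_sets]
  have "(\<lambda>x. x 1) -` E \<inter> space ?R \<inter> ((\<lambda>x. restrict x {2..N}) -` F \<inter> space ?R) \<in> sets ?R" by blast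
  also have "(\<lambda>x. x 1) -` E \<inter> space ?R \<inter> ((\<lambda>x. restrict x {2..N}) -` F \<inter> space ?R) = ?B" by blast
  finally have B_sets: "?B \<in> sets ?R" .
  have "assemble z 1 = fst z" for z using one_mem by (simp add: assemble_def)
  then have A_eq_vimage: "A = assemble -` ?B \<inter> space ?M"
    using measurable_space[OF assemble_measurable] unfolding A_def by auto
  show "A \<in> sets ?M" unfolding A_eq_vimage by (rule measurable_sets[OF assemble_measurable B_sets])
  have "emeasure P ?B = emeasure (distr (marginal_1j j0 P) ?R assemble) ?B"
    using optimal_plan_eq_distr_assemble[OF opt] by simp
  also have "\<dots> = emeasure (marginal_1j j0 P) A"
    using assemble_measurable B_sets by (simp add: emeasure_distr A_eq_vimage)
  finally show "emeasure P {x \<in> space P. x 1 \<in> E \<and> restrict x {2..N} \<in> F} =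
      emeasure (marginal_1j j0 P) A"
    by (simp only: sets_eq_imp_space_eq[OF plan_sets[OF plan]])
qed

theorem optimal_plan_disintegration:
  assumes opt: "opt_MK N \<mu> c P" and kernel: "\<kappa> \<in> \<mu> 1 \<rightarrow>\<^sub>M prob_algebra (\<mu> j0)"
    and disintegration: "\<And>E F. E \<in> sets (\<mu> 1) \<Longrightarrow> F \<in> sets (\<mu> j0) \<Longrightarrow>
       emeasure P {x \<in> space P. x 1 \<in> E \<and> x j0 \<in> F} = (\<integral>\<^sup>+ x1\<in>E. emeasure (\<kappa> x1) F \<partial>\<mu> 1)"
    and E_sets: "E \<in> sets (\<mu> 1)" and F_sets: "F \<in> sets (PiM {2..N} \<mu>)"
  shows "emeasure P {x \<in> space P. x 1 \<in> E \<and> restrict x {2..N} \<in> F} =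
    (\<integral>\<^sup>+ x1\<in>E. emeasure (PiM {2..N} (\<lambda>j. if j = j0 then \<kappa> x1 else return (\<mu> j) (T j x1))) F \<partial>\<mu> 1)"
proof -
  have plan: "P \<in> plans N \<mu>" by (rule opt_MK_imp_plan[OF opt])
  let ?A = "{z \<in> space (\<mu> 1 \<Otimes>\<^sub>M \<mu> j0). fst z \<in> E \<and> restrict (assemble z) {2..N} \<in> F}"
  have "emeasure P {x \<in> space P. x 1 \<in> E \<and> restrict x {2..N} \<in> F} =
      (\<integral>\<^sup>+ x. emeasure (\<kappa> x) (Pair x -` ?A) \<partial>\<mu> 1)"
    unfolding emeasure_optimal_plan(2)[OF opt E_sets F_sets]
    by (rule emeasure_marginal_1j0[OF plan kernel disintegration
      emeasure_optimal_plan(1)[OF opt E_sets F_sets]])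
  also have "\<dots> = (\<integral>\<^sup>+ x1\<in>E. emeasure (PiM {2..N}
      (\<lambda>j. if j = j0 then \<kappa> x1 else return (\<mu> j) (T j x1))) F \<partial>\<mu> 1)"
  proof (rule nn_integral_cong)
    fix x assume x: "x \<in> space (\<mu> 1)"
    have \<kappa>x: "prob_space (\<kappa> x)" "sets (\<kappa> x) = sets (\<mu> j0)"
      using measurable_space[OF kernel x] by (auto simp: space_prob_algebra)
    have "Pair x -` ?A =
        (if x \<in> E then {y \<in> space (\<kappa> x). restrict (assemble (x, y)) {2..N} \<in> F} else {})"
      using x sets_eq_imp_space_eq[OF \<kappa>x(2)] by (auto simp: space_pair_measure)
    then show "emeasure (\<kappa> x) (Pair x -` ?A) =
        emeasure (PiM {2..N} (\<lambda>j. if j = j0 then \<kappa> x else return (\<mu> j) (T j x))) F * indicator E x"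
      by (simp add: emeasure_PiM_assemble[OF x \<kappa>x F_sets])
  qed
  finally show ?thesis .
qed

end

theorem mainTheorem6:
  fixes N j0 :: nat
    and X :: "nat \<Rightarrow> 'a metric"
    and \<mu> :: "nat \<Rightarrow> 'a measure"
    and c :: "(nat \<Rightarrow> 'a) \<Rightarrow> real"
    and a \<phi> :: "nat \<Rightarrow> 'a \<Rightarrow> real"
    and T :: "nat \<Rightarrow> 'a \<Rightarrow> 'a"
  assumes N3: "N \<ge> 3"
    and j0: "j0 \<in> {2..N}"
    and polish: "\<And>k. k \<in> {1..N} \<Longrightarrow> mcomplete_of (X k) \<and> separable_space (mtopology_of (X k))"
    and borel: "\<And>k. k \<in> {1..N} \<Longrightarrow> prob_space (\<mu> k) \<and> sets (\<mu> k) = sets (borel_of (mtopology_of (X k)))"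
    and lsc: "lsc_top (product_topology (\<lambda>k. mtopology_of (X k)) {1..N}) c"
    and a_int: "\<And>k. k \<in> {1..N} \<Longrightarrow> integrable (\<mu> k) (a k)"
    and c_lb: "\<And>x. x \<in> PiE {1..N} (\<lambda>k. mspace (X k)) \<Longrightarrow> (\<Sum>k\<in>{1..N}. a k (x k)) \<le> c x"
    and attained: "\<exists>P. opt_MK N \<mu> c P"
    and dual: "dual_sol N X \<mu> c \<phi>"
    and maps: "\<And>j. j \<in> {2..N} - {j0} \<Longrightarrow>
        T j \<in> measurable (\<mu> 1) (\<mu> j) \<and>
        (\<forall>\<tau>. opt2 (\<mu> 1) (\<mu> j) (case_prod (cost_1j N X c \<phi> j)) \<tau> \<longleftrightarrow>
              \<tau> = distr (\<mu> 1) (\<mu> 1 \<Otimes>\<^sub>M \<mu> j) (\<lambda>x. (x, T j x)))"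
  shows "(\<forall>P \<kappa>. opt_MK N \<mu> c P \<and> \<kappa> \<in> measurable (\<mu> 1) (prob_algebra (\<mu> j0)) \<and>
            (\<forall>E\<in>sets (\<mu> 1). \<forall>F\<in>sets (\<mu> j0).
               emeasure P {x \<in> space P. x 1 \<in> E \<and> x j0 \<in> F}
                 = (\<integral>\<^sup>+ x1\<in>E. emeasure (\<kappa> x1) F \<partial>\<mu> 1)) \<longrightarrow>
            (\<forall>E\<in>sets (\<mu> 1). \<forall>F\<in>sets (PiM {2..N} \<mu>).
               emeasure P {x \<in> space P. x 1 \<in> E \<and> restrict x {2..N} \<in> F}
                 = (\<integral>\<^sup>+ x1\<in>E. emeasure (PiM {2..N} (\<lambda>j. if j = j0 then \<kappa> x1
                                                    else return (\<mu> j) (T j x1))) F \<partial>\<mu> 1)))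
       \<and> ((\<exists>!\<tau>. opt2 (\<mu> 1) (\<mu> j0) (case_prod (cost_1j N X c \<phi> j0)) \<tau>) \<longrightarrow>
            (\<exists>!P. opt_MK N \<mu> c P))"
proof -
  have "N \<ge> 1" using N3 by simp
  interpret transport_maps N X \<mu> c a \<phi> j0 T
    by (intro transport_maps.intro dual_optimum.intro multimarginal.intro
        transport_maps_axioms.intro dual_optimum_axioms.intro)
      (fact \<open>N \<ge> 1\<close> polish borel lsc a_int c_lb dual j0 maps)+
  obtain P where P: "opt_MK N \<mu> c P" using attained ..
  show ?thesis
  proof (intro conjI allI impI ballI)
    assume "\<exists>!\<tau>. opt2 (\<mu> 1) (\<mu> j0) (case_prod (cost_1j N X c \<phi> j0)) \<tau>"
    then show "\<exists>!P. opt_MK N \<mu> c P"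
      by (intro ex1I[of "opt_MK N \<mu> c", OF P] optimal_plan_unique[OF _ _ P])
  qed (rule optimal_plan_disintegration; blast)
qed

end
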